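(* Let $A\in\mathfrak{her}_N$ and $P:=(P_1,\dots,P_r)\in\mathrm{Gr}^{\times r}(\mathbf m,\mathbf n)$. Then the Riemannian Hessian of $\rho_A$ at $P$ is the unique self-adjoint operator $$\mathbf H_{\rho_A}(P):\mathrm T_P\mathrm{Gr}^{\times r}(\mathbf m,\mathbf n)\to\mathrm T_P\mathrm{Gr}^{\times r}(\mathbf m,\mathbf n),\qquad \xi=(\xi_1,\dots,\xi_r)\mapsto\big(\mathbf H_1(\xi),\dots,\mathbf H_r(\xi)\big),$$ defined by $$\mathbf H_j(\xi):=-\mathrm{ad}_{P_j}\mathrm{ad}_{\widehat A_j}\xi_j+\sum_{k=1,\,k\ne j}^r\mathrm{ad}^2_{P_j}\,\Psi_{A,j}(P_1,\dots,I_{n_j},\dots,\xi_k,\dots,P_r),\qquad j=1,\dots,r,$$ where in the $k$-th summand the argument of $\Psi_{A,j}$ has $I_{n_j}$ in position $j$, $\xi_k$ in position $k$, and $P_l$ in every other position $l$, and where $\widehat A_j:=\Psi_{A,j}(P_1,\dots,I_{n_j},\dots,P_r)$ (with $I_{n_j}$ in position $j$ and $P_l$ in every position $l\neq j$).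
   Context: Let $r\ge 1$, $1\le m_j\le n_j$ be integers for $j=1,\dots,r$, $N:=n_1\cdots n_r$, $(\mathbf m,\mathbf n):=((m_1,n_1),\dots,(m_r,n_r))$. $\mathfrak{her}_n$ is the real vector space of Hermitian $n\times n$ complex matrices. $\mathrm{Gr}_{m,n}:=\{P\in\mathbb{C}^{n\times n}\mid P=P^\dagger=P^2,\ \operatorname{tr}P=m\}$, a smooth submanifold of $\mathfrak{her}_n$, and $\mathrm{Gr}^{\times r}(\mathbf m,\mathbf n):=\mathrm{Gr}_{m_1,n_1}\times\cdots\times\mathrm{Gr}_{m_r,n_r}\subset\mathfrak{her}_{n_1}\times\cdots\times\mathfrak{her}_{n_r}$, with the Riemannian metric induced by $\langle (X_j),(Y_j)\rangle=\sum_j\operatorname{tr}(X_jY_j)$. The generalized Rayleigh-quotient is $\rho_A:\mathrm{Gr}^{\times r}(\mathbf m,\mathbf n)\to\mathbb{R}$, $\rho_A(P_1,\dots,P_r)=\operatorname{tr}(A(P_1\otimes\cdots\otimes P_r))$, with $\otimes$ the Kronecker product. $[X,Y]=XY-YX$, $\mathrm{ad}_XY=[X,Y]$, $\mathrm{ad}_P^2X=[P,[P,X]]$. For $(X_1,\dots,X_r)\in\mathfrak{her}_{n_1}\times\cdots\times\mathfrak{her}_{n_r}$, $\Psi_{A,j}(X_1,\dots,X_r)\in\mathbb{C}^{n_j\times n_j}$ is the unique matrix such that $\operatorname{tr}\big(A(X_1\otimes\cdots\otimes X_jZ\otimes\cdots\otimes X_r)\big)=\operatorname{tr}\big(\Psi_{A,j}(X_1,\dots,X_r)Z\big)$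 for all $Z\in\mathbb{C}^{n_j\times n_j}$. The Riemannian Hessian of a smooth function $f$ on a Riemannian manifold is $\mathbf H_f(P)\xi=\boldsymbol\nabla_\xi\operatorname{grad}f(P)$, with $\boldsymbol\nabla$ the Levi-Civita connection and $\operatorname{grad}f$ the Riemannian gradient. *)

theory Defs
  imports "HOL-Analysis.Analysis"
begin

section \<open>Smooth maps on embedded submanifolds of a Euclidean space\<close>

text \<open>Class C-k on an open set: all iterated directional derivatives up to order k exist, the
  lower-order ones are totally differentiable, and those of order k are continuous.\<close>

primrec Ck_on :: "nat \<Rightarrow> 'a::real_normed_vector set \<Rightarrow> ('a \<Rightarrow> 'b::real_normed_vector) \<Rightarrow> bool" where
  "Ck_on 0 U f \<longleftrightarrow> continuous_on U f"
| "Ck_on (Suc k) U f \<longleftrightarrow>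
     (\<forall>x\<in>U. f differentiable (at x)) \<and> (\<forall>v. Ck_on k U (\<lambda>x. frechet_derivative f (at x) v))"

definition smooth_on_open :: "'a::real_normed_vector set \<Rightarrow> ('a \<Rightarrow> 'b::real_normed_vector) \<Rightarrow> bool" where
  "smooth_on_open U f \<longleftrightarrow> open U \<and> (\<forall>k. Ck_on k U f)"

text \<open>In the following, \<open>M\<close> is meant to be an embedded submanifold of the Euclidean space
  \<open>'e\<close>. Functions and vector fields on \<open>M\<close> are total functions on \<open>'e\<close> of which
  only the values on \<open>M\<close> matter. Smoothness on \<open>M\<close> means that there are local smooth
  extensions, and a tangent vector is the velocity of a smooth curve in \<open>M\<close>.\<close>

definition smooth_map :: "'e::euclidean_space set \<Rightarrow> ('e \<Rightarrow> 'b::real_normed_vector) \<Rightarrow> bool" where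
  "smooth_map M f \<longleftrightarrow>
     (\<forall>p\<in>M. \<exists>U g. p \<in> U \<and> smooth_on_open U g \<and> (\<forall>x\<in>U \<inter> M. g x = f x))"

definition curve_with_velocity :: "'e::euclidean_space set \<Rightarrow> 'e \<Rightarrow> 'e \<Rightarrow> (real \<Rightarrow> 'e) \<Rightarrow> bool" where
  "curve_with_velocity M p v c \<longleftrightarrow>
     (\<exists>\<epsilon>>0. smooth_on_open {-\<epsilon><..<\<epsilon>} c \<and> c ` {-\<epsilon><..<\<epsilon>} \<subseteq> M) \<and>
     c 0 = p \<and> (c has_vector_derivative v) (at 0)"

definition tangent_space :: "'e::euclidean_space set \<Rightarrow> 'e \<Rightarrow> 'e set" where
  "tangent_space M p = {v. \<exists>c. curve_with_velocity M p v c}"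

definition smooth_field :: "'e::euclidean_space set \<Rightarrow> ('e \<Rightarrow> 'e) \<Rightarrow> bool" where
  "smooth_field M X \<longleftrightarrow> smooth_map M X \<and> (\<forall>p\<in>M. X p \<in> tangent_space M p)"

text \<open>The differential of \<open>f\<close> at \<open>p \<in> M\<close>, applied to a tangent vector \<open>v\<close>.\<close>

definition mdiff :: "'e::euclidean_space set \<Rightarrow> ('e \<Rightarrow> real) \<Rightarrow> 'e \<Rightarrow> 'e \<Rightarrow> real" where
  "mdiff M f p v =
     (THE d. \<forall>c. curve_with_velocity M p v c \<longrightarrow>
        ((\<lambda>t. f (c t)) has_real_derivative d) (at 0))"

section \<open>Gradient, Levi-Civita connection and Hessian for the induced metric\<close>

text \<open>The Riemannian metric on \<open>M\<close> is the restriction of the inner product of \<open>'e\<close>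
  to the tangent spaces.\<close>

definition riem_grad :: "'e::euclidean_space set \<Rightarrow> ('e \<Rightarrow> real) \<Rightarrow> 'e \<Rightarrow> 'e" where
  "riem_grad M f p =
     (THE g. g \<in> tangent_space M p \<and> (\<forall>v\<in>tangent_space M p. mdiff M f p v = g \<bullet> v))"

text \<open>\<open>nab p v Y\<close> is the covariant derivative at \<open>p\<close> of the field \<open>Y\<close> in the
  direction of the tangent vector \<open>v\<close>. Torsion-freeness, i.e.\ that the difference of the
  covariant derivatives is the Lie bracket of the two fields, is expressed through the action of
  tangent vectors as derivations on smooth functions.\<close>

definition affine_connection :: "'e::euclidean_space set \<Rightarrow> ('e \<Rightarrow> 'e \<Rightarrow> ('e \<Rightarrow> 'e) \<Rightarrow> 'e) \<Rightarrow> bool" where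
  "affine_connection M nab \<longleftrightarrow>
     (\<forall>X Y. smooth_field M X \<and> smooth_field M Y \<longrightarrow> smooth_field M (\<lambda>p. nab p (X p) Y)) \<and>
     (\<forall>p\<in>M. \<forall>v\<in>tangent_space M p. \<forall>Y. smooth_field M Y \<longrightarrow>
        nab p v Y \<in> tangent_space M p \<and>
        (\<forall>w\<in>tangent_space M p. \<forall>a b.
           nab p (a *\<^sub>R v + b *\<^sub>R w) Y = a *\<^sub>R nab p v Y + b *\<^sub>R nab p w Y) \<and>
        (\<forall>Z. smooth_field M Z \<longrightarrow> nab p v (\<lambda>q. Y q + Z q) = nab p v Y + nab p v Z) \<and>
        (\<forall>f::'e \<Rightarrow> real. smooth_map M f \<longrightarrow>
           nab p v (\<lambda>q. f q *\<^sub>R Y q) = mdiff M f p v *\<^sub>R Y p + f p *\<^sub>R nab p v Y))"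

definition metric_compatible :: "'e::euclidean_space set \<Rightarrow> ('e \<Rightarrow> 'e \<Rightarrow> ('e \<Rightarrow> 'e) \<Rightarrow> 'e) \<Rightarrow> bool" where
  "metric_compatible M nab \<longleftrightarrow>
     (\<forall>p\<in>M. \<forall>v\<in>tangent_space M p. \<forall>Y Z. smooth_field M Y \<and> smooth_field M Z \<longrightarrow>
        mdiff M (\<lambda>q. Y q \<bullet> Z q) p v = nab p v Y \<bullet> Z p + Y p \<bullet> nab p v Z)"

definition torsion_free :: "'e::euclidean_space set \<Rightarrow> ('e \<Rightarrow> 'e \<Rightarrow> ('e \<Rightarrow> 'e) \<Rightarrow> 'e) \<Rightarrow> bool" where
  "torsion_free M nab \<longleftrightarrow>
     (\<forall>X Y. smooth_field M X \<and> smooth_field M Y \<longrightarrow>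
        (\<forall>f. smooth_map M f \<longrightarrow> (\<forall>p\<in>M.
           mdiff M f p (nab p (X p) Y - nab p (Y p) X) =
           mdiff M (\<lambda>q. mdiff M f q (Y q)) p (X p) - mdiff M (\<lambda>q. mdiff M f q (X q)) p (Y p))))"

definition is_levi_civita :: "'e::euclidean_space set \<Rightarrow> ('e \<Rightarrow> 'e \<Rightarrow> ('e \<Rightarrow> 'e) \<Rightarrow> 'e) \<Rightarrow> bool" where
  "is_levi_civita M nab \<longleftrightarrow> affine_connection M nab \<and> metric_compatible M nab \<and> torsion_free M nab"

text \<open>The choice below is immaterial on points of \<open>M\<close>, tangent vectors and smooth vector
  fields; \<open>SOME\<close> instead of \<open>THE\<close> is needed because the values at other arguments are
  unconstrained.\<close>

definition levi_civita :: "'e::euclidean_space set \<Rightarrow> 'e \<Rightarrow> 'e \<Rightarrow> ('e \<Rightarrow> 'e) \<Rightarrow> 'e" where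
  "levi_civita M = (SOME nab. is_levi_civita M nab)"

definition riem_hessian :: "'e::euclidean_space set \<Rightarrow> ('e \<Rightarrow> real) \<Rightarrow> 'e \<Rightarrow> 'e \<Rightarrow> 'e" where
  "riem_hessian M f p v = levi_civita M p v (riem_grad M f)"

definition self_adjoint_on :: "'e::euclidean_space set \<Rightarrow> ('e \<Rightarrow> 'e) \<Rightarrow> bool" where
  "self_adjoint_on T H \<longleftrightarrow>
     H ` T \<subseteq> T \<and>
     (\<forall>x\<in>T. \<forall>y\<in>T. \<forall>a b. H (a *\<^sub>R x + b *\<^sub>R y) = a *\<^sub>R H x + b *\<^sub>R H y) \<and>
     (\<forall>x\<in>T. \<forall>y\<in>T. H x \<bullet> y = x \<bullet> H y)"

section \<open>Matrices indexed by a finite set\<close>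

text \<open>To allow sizes \<open>n\<^sub>j\<close> that vary with \<open>j\<close>, complex matrices with row and column index
  set \<open>S\<close> are the matrices over the ambient finite index type that vanish outside
  \<open>S \<times> S\<close>. On them, the library's matrix product and trace are those of
  \<open>S \<times> S\<close>-matrices; the unit matrix is \<open>idm S\<close>.\<close>

definition cmats :: "'i set \<Rightarrow> (complex^'i^'i) set" where
  "cmats S = {X. \<forall>a b. \<not> (a \<in> S \<and> b \<in> S) \<longrightarrow> X $ a $ b = 0}"

definition idm :: "'i set \<Rightarrow> complex^'i^'i" where
  "idm S = (\<chi> a b. if a = b \<and> a \<in> S then 1 else 0)"

definition dagger :: "complex^'i^'i \<Rightarrow> complex^'i^'i" where
  "dagger X = (\<chi> a b. cnj (X $ b $ a))"

definition her :: "'i set \<Rightarrow> (complex^'i^'i) set" where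
  "her S = {X \<in> cmats S. dagger X = X}"

definition ad :: "complex^'i^'i \<Rightarrow> complex^'i^'i \<Rightarrow> complex^'i^'i" where
  "ad X Y = X ** Y - Y ** X"

definition grassmann :: "'i::finite set \<Rightarrow> nat \<Rightarrow> (complex^'i^'i) set" where
  "grassmann S m = {P \<in> cmats S. P = dagger P \<and> P = P ** P \<and> trace P = of_nat m}"

section \<open>Tuples of matrices\<close>

text \<open>A tuple \<open>(X\<^sub>1, \<dots>, X\<^sub>r)\<close> has index type \<open>'r\<close>, and \<open>I j\<close> is the index
  set of the \<open>j\<close>-th component.\<close>

definition her_prod :: "('r \<Rightarrow> 'i set) \<Rightarrow> (complex^'i^'i^'r) set" where
  "her_prod I = {X. \<forall>j. X $ j \<in> her (I j)}"

definition grassmann_prod :: "('r \<Rightarrow> 'i::finite set) \<Rightarrow> ('r \<Rightarrow> nat) \<Rightarrow> (complex^'i^'i^'r) set" where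
  "grassmann_prod I m = {P. \<forall>j. P $ j \<in> grassmann (I j) (m j)}"

definition upd :: "'a^'r \<Rightarrow> 'r \<Rightarrow> 'a \<Rightarrow> 'a^'r" where
  "upd X j Y = (\<chi> k. if k = j then Y else X $ k)"

text \<open>Rows and columns of \<open>X\<^sub>1 \<otimes> \<dots> \<otimes> X\<^sub>r\<close> are indexed by multi-indices.\<close>

definition multi :: "('r \<Rightarrow> 'i set) \<Rightarrow> ('r \<Rightarrow> 'i) set" where
  "multi I = {f. \<forall>j. f j \<in> I j}"

definition kron :: "complex^'i^'i^'r \<Rightarrow> complex^('r::finite \<Rightarrow> 'i::finite)^('r \<Rightarrow> 'i)" where
  "kron X = (\<chi> f g. \<Prod>j\<in>UNIV. X $ j $ f j $ g j)"

text \<open>The trace below is real for Hermitian \<open>A\<close> and \<open>P\<close>.\<close>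

definition rayleigh :: "complex^('r::finite \<Rightarrow> 'i::finite)^('r \<Rightarrow> 'i) \<Rightarrow> complex^'i^'i^'r \<Rightarrow> real" where
  "rayleigh A P = Re (trace (A ** kron P))"

definition Psi :: "('r \<Rightarrow> 'i set) \<Rightarrow> complex^('r::finite \<Rightarrow> 'i::finite)^('r \<Rightarrow> 'i) \<Rightarrow> 'r \<Rightarrow>
    complex^'i^'i^'r \<Rightarrow> complex^'i^'i" where
  "Psi I A j X = (THE B. B \<in> cmats (I j) \<and>
     (\<forall>Z\<in>cmats (I j). trace (A ** kron (upd X j (X $ j ** Z))) = trace (B ** Z)))"

section \<open>Consistency of the encoding\<close>

lemma card_multi:
  fixes I :: "'r::finite \<Rightarrow> 'i::finite set"
  shows "card (multi I) = (\<Prod>j\<in>UNIV. card (I j))"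
proof -
  have "multi I = PiE UNIV I" by (auto simp: multi_def PiE_def Pi_def)
  then show ?thesis by (simp add: card_PiE)
qed

lemma kron_in_cmats:
  fixes X :: "complex^'i::finite^'i^'r::finite"
  assumes "\<And>j. X $ j \<in> cmats (I j)"
  shows "kron X \<in> cmats (multi I)"
proof -
  have "(\<Prod>j\<in>UNIV. X $ j $ f j $ g j) = 0" if h: "\<not> (f j \<in> I j \<and> g j \<in> I j)" for f g j
  proof -
    have "X $ j $ f j $ g j = 0" using assms[of j] h by (auto simp: cmats_def)
    then show ?thesis by (intro prod_zero) auto
  qed
  then show ?thesis by (auto simp: cmats_def multi_def kron_def)
qed

lemma inner_her_prod:
  fixes X Y :: "complex^'i::finite^'i^'r::finite"
  assumes "X \<in> her_prod I" "Y \<in> her_prod I"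
  shows "complex_of_real (X \<bullet> Y) = (\<Sum>j\<in>UNIV. trace (X $ j ** Y $ j))"
proof -
  have herX: "X $ j $ a $ b = cnj (X $ j $ b $ a)" and herY: "Y $ j $ a $ b = cnj (Y $ j $ b $ a)" for j a b
    using assms unfolding her_prod_def her_def dagger_def by (auto simp: vec_eq_iff)
  have sw: "(\<Sum>a\<in>UNIV. \<Sum>b\<in>UNIV. X $ j $ a $ b * Y $ j $ b $ a)
      = (\<Sum>a\<in>UNIV. \<Sum>b\<in>UNIV. cnj (X $ j $ a $ b * Y $ j $ b $ a))" for j
    by (subst sum.swap, intro sum.cong refl) (simp add: herX[symmetric] herY[symmetric])
  have "Im (\<Sum>a\<in>UNIV. \<Sum>b\<in>UNIV. X $ j $ a $ b * Y $ j $ b $ a) = 0" (is "Im ?S = 0") for j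
  proof -
    have "?S = cnj ?S" by (subst sw) simp
    then have "Im ?S = - Im ?S" by (metis cnj.sel(2))
    then show ?thesis by simp
  qed
  moreover have "Re (X $ j $ a $ b * Y $ j $ b $ a) = X $ j $ a $ b \<bullet> Y $ j $ a $ b" for j a b
    by (subst (2) herY) (simp add: inner_complex_def)
  ultimately show ?thesis
    by (simp add: complex_eq_iff inner_vec_def trace_def matrix_matrix_mult_def)
qed

lemma Psi_well_defined:
  fixes A :: "complex^('r::finite \<Rightarrow> 'i::finite)^('r \<Rightarrow> 'i)"
  shows "\<exists>!B. B \<in> cmats (I j) \<and>
     (\<forall>Z\<in>cmats (I j). trace (A ** kron (upd X j (X $ j ** Z))) = trace (B ** Z))"
proof (rule ex_ex1I)
  define c where "c f g = (\<Prod>k\<in>UNIV - {j}. X $ k $ f k $ g k)" for f g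
  define B :: "complex^'i^'i" where
    "B = (\<chi> a b. if a \<in> I j \<and> b \<in> I j
       then \<Sum>f\<in>UNIV. \<Sum>g\<in>UNIV. if f j = a then A $ f $ g * c g f * X $ j $ g j $ b else 0 else 0)"
  show "\<exists>B. B \<in> cmats (I j) \<and>
     (\<forall>Z\<in>cmats (I j). trace (A ** kron (upd X j (X $ j ** Z))) = trace (B ** Z))"
  proof (intro exI conjI ballI)
    show "B \<in> cmats (I j)" by (auto simp: B_def cmats_def)
    fix Z assume Z: "Z \<in> cmats (I j)"
    have k: "kron (upd X j W) $ g $ f = W $ g j $ f j * c g f" for W g f
      unfolding kron_def c_def by (simp add: upd_def prod.remove[of UNIV j])
    have "trace (A ** kron (upd X j (X $ j ** Z))) =
        (\<Sum>f\<in>UNIV. \<Sum>g\<in>UNIV. \<Sum>b\<in>UNIV. A $ f $ g * c g f * X $ j $ g j $ b * Z $ b $ f j)"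
      by (simp add: trace_def matrix_matrix_mult_def k sum_distrib_left sum_distrib_right mult_ac)
    also have "\<dots> = (\<Sum>f\<in>UNIV. \<Sum>g\<in>UNIV. \<Sum>b\<in>UNIV. \<Sum>a\<in>UNIV.
        if f j = a then A $ f $ g * c g f * X $ j $ g j $ b * Z $ b $ a else 0)"
      by simp
    also have "\<dots> = (\<Sum>a\<in>UNIV. \<Sum>b\<in>UNIV. \<Sum>f\<in>UNIV. \<Sum>g\<in>UNIV.
        if f j = a then A $ f $ g * c g f * X $ j $ g j $ b * Z $ b $ a else 0)"
      by (simp only: sum.swap[of _ "UNIV::'i set" "UNIV::('r \<Rightarrow> 'i) set"])
         (rule sum.swap)
    also have "\<dots> = (\<Sum>a\<in>UNIV. \<Sum>b\<in>UNIV. B $ a $ b * Z $ b $ a)"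
    proof (intro sum.cong refl)
      fix a b
      show "(\<Sum>f\<in>UNIV. \<Sum>g\<in>UNIV.
        if f j = a then A $ f $ g * c g f * X $ j $ g j $ b * Z $ b $ a else 0) = B $ a $ b * Z $ b $ a"
      proof (cases "a \<in> I j \<and> b \<in> I j")
        case True
        then show ?thesis
          by (simp add: B_def sum_distrib_right if_distrib[of "\<lambda>x. x * _"] cong: if_cong)
      next
        case False
        then have "Z $ b $ a = 0" using Z by (auto simp: cmats_def)
        then show ?thesis by (simp cong: if_cong)
      qed
    qed
    also have "\<dots> = trace (B ** Z)"
      by (simp add: trace_def matrix_matrix_mult_def)
    finally show "trace (A ** kron (upd X j (X $ j ** Z))) = trace (B ** Z)" .
  qed
next
  fix B C
  assume B: "B \<in> cmats (I j) \<and>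
     (\<forall>Z\<in>cmats (I j). trace (A ** kron (upd X j (X $ j ** Z))) = trace (B ** Z))"
    and C: "C \<in> cmats (I j) \<and>
     (\<forall>Z\<in>cmats (I j). trace (A ** kron (upd X j (X $ j ** Z))) = trace (C ** Z))"
  have "B $ a $ b = C $ a $ b" for a b
  proof (cases "a \<in> I j \<and> b \<in> I j")
    case True
    define E :: "complex^'i^'i" where "E = (\<chi> x y. if x = b \<and> y = a then 1 else 0)"
    have "E \<in> cmats (I j)" using True by (auto simp: E_def cmats_def)
    then have "trace (B ** E) = trace (C ** E)" using B C by metis
    moreover have "trace (D ** E) = D $ a $ b" for D
    proof -
      have "D $ x $ y * (if y = b \<and> x = a then 1 else 0) =
          (if y = b then if x = a then D $ x $ y else 0 else 0)" for x y by simp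
      then show ?thesis by (simp add: trace_def matrix_matrix_mult_def E_def)
    qed
    ultimately show ?thesis by simp
  next
    case False
    then show ?thesis using B C by (auto simp: cmats_def)
  qed
  then show "B = C" by (simp add: vec_eq_iff)
qed

end

(* Along the product of Grassmannians the tangent space at P is the image of the orthogonal projection
   v |-> (ad_{P_j}^2 v_j) of the Hermitian tuples. Projecting the derivative of a vector field in the
   ambient Euclidean space to the tangent spaces gives a Levi-Civita connection, and it is the only one.
   So the gradient of a function is the projected Euclidean gradient, and the Hessian is the projected
   derivative of the gradient. For the Rayleigh quotient the Euclidean gradient is the tuple of partial
   traces A_hat_j, and in the derivative of ad_{P_j}^2 A_hat_j along the manifold the term
   [xi_j, [P_j, A_hat_j]], a commutator of two block off-diagonal matrices, is killed by ad_{P_j}. *)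

theory Submission
  imports Defs
begin

text \<open>The connection in the Hessian is a \<open>SOME\<close> choice, so nothing can be read
  off it: a concrete connection has to be exhibited and then shown to agree with every other one on
  smooth fields. Uniqueness needs a global field through a given tangent vector \<open>v\<close>;
  projecting the constant field, i.e. taking \<open>\<pi> q v\<close> as a function of
  \<open>q\<close>, gives one without cut-off functions or charts. This works because
  \<open>ad_sq\<close> is polynomial in its base point and hence smooth on the whole ambient space,
  although it is a projection only at points of the manifold. Existence hinges on torsion: the
  bracket of two tangent fields must be tangent before it is projected. That is the symmetry of the
  derivative of the projection, which for Grassmannians comes from the Jacobi identity. Tangent
  vectors are velocities of curves inside the manifold, so showing that every fixed vector of the
  projection is tangent requires actual curves; the matrix exponential supplies them.\<close>

section \<open>Calculus of smooth maps\<close>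

lemma has_derivative_frechet:
  "f differentiable (at x) \<Longrightarrow> (f has_derivative frechet_derivative f (at x)) (at x)"
  by (simp add: frechet_derivative_works[symmetric])

lemma Ck_on_cong:
  assumes "open U" "\<And>x. x \<in> U \<Longrightarrow> f x = g x" "Ck_on k U f"
  shows "Ck_on k U g"
  using assms(2,3)
proof (induction k arbitrary: f g)
  case 0
  then show ?case by (simp cong: continuous_on_cong)
next
  case (Suc k)
  have d: "(g has_derivative frechet_derivative f (at x)) (at x)" if "x \<in> U" for x
    using Suc.prems that assms(1)
    by (intro has_derivative_transform_within_open[OF has_derivative_frechet]) auto
  have fd: "frechet_derivative g (at x) = frechet_derivative f (at x)" if "x \<in> U" for x
    using d[OF that] frechet_derivative_at by metis
  show ?case
    unfolding Ck_on.simps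
  proof (intro conjI ballI allI)
    show "g differentiable at x" if "x \<in> U" for x
      using d[OF that] unfolding differentiable_def by blast
    show "Ck_on k U (\<lambda>x. frechet_derivative g (at x) v)" for v
      by (rule Suc.IH[of "\<lambda>x. frechet_derivative f (at x) v"]) (use Suc.prems fd in auto)
  qed
qed

lemma Ck_on_subset: "Ck_on k U f \<Longrightarrow> V \<subseteq> U \<Longrightarrow> Ck_on k V f"
  by (induction k arbitrary: f) (auto intro: continuous_on_subset)

lemma Ck_on_SucD: "Ck_on (Suc k) U f \<Longrightarrow> Ck_on k U f"
proof (induction k arbitrary: f)
  case 0
  then show ?case
    by (auto intro!: continuous_at_imp_continuous_on differentiable_imp_continuous_within)
next
  case (Suc k)
  then show ?case by (metis Ck_on.simps(2))
qed

text \<open>Permits inductions on the order with an explicit formula for the derivative instead of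
  \<open>frechet_derivative\<close>.\<close>

lemma Ck_on_SucI:
  assumes "open U" "\<And>x. x \<in> U \<Longrightarrow> (f has_derivative f' x) (at x)"
    and "\<And>v. Ck_on k U (\<lambda>x. f' x v)"
  shows "Ck_on (Suc k) U f"
  unfolding Ck_on.simps
proof (intro conjI ballI allI)
  show "f differentiable at x" if "x \<in> U" for x
    using assms(2)[OF that] unfolding differentiable_def by blast
  show "Ck_on k U (\<lambda>x. frechet_derivative f (at x) v)" for v
    by (rule Ck_on_cong[OF assms(1) _ assms(3)[of v]])
       (metis assms(2) frechet_derivative_at)
qed

lemma Ck_on_const: "Ck_on k U (\<lambda>x. c)"
  by (induction k arbitrary: c) auto

lemma Ck_on_linear:
  assumes "bounded_linear f"
  shows "Ck_on k U f"
proof (cases k)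
  case 0
  then show ?thesis using assms by (simp add: linear_continuous_on)
next
  case (Suc j)
  have "frechet_derivative f (at x) = f" for x
    using bounded_linear_imp_has_derivative[OF assms] frechet_derivative_at by metis
  then show ?thesis using assms
    by (auto simp: Suc Ck_on_const bounded_linear_imp_differentiable)
qed

lemma Ck_on_add:
  assumes "open U" "Ck_on k U f" "Ck_on k U g"
  shows "Ck_on k U (\<lambda>x. f x + g x)"
  using assms(2,3)
proof (induction k arbitrary: f g)
  case 0
  then show ?case by (auto intro: continuous_intros)
next
  case (Suc k)
  show ?case
    by (rule Ck_on_SucI[OF assms(1) has_derivative_add[OF has_derivative_frechet has_derivative_frechet]])
       (use Suc in auto)
qed

text \<open>The product rule expresses the derivative as a sum of terms of the same bilinear shape,
  so the induction closes. One statement covers scalar multiples, inner products, matrix products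
  and commutators.\<close>

lemma Ck_on_bilinear:
  assumes "open U" "bounded_bilinear h" "Ck_on k U f" "Ck_on k U g"
  shows "Ck_on k U (\<lambda>x. h (f x) (g x))"
  using assms(3,4)
proof (induction k arbitrary: f g)
  case 0
  then show ?case by (auto intro: bounded_bilinear.continuous_on[OF assms(2)])
next
  case (Suc k)
  show ?case
  proof (rule Ck_on_SucI[OF assms(1) bounded_bilinear.FDERIV[OF assms(2) has_derivative_frechet has_derivative_frechet]])
    fix v
    show "Ck_on k U (\<lambda>x. h (f x) (frechet_derivative g (at x) v) + h (frechet_derivative f (at x) v) (g x))"
      using Suc.prems by (intro Ck_on_add[OF assms(1)] Suc.IH) (auto intro: Ck_on_SucD)
  qed (use Suc.prems in auto)
qed

lemma Ck_on_sum:
  assumes "open U" "\<And>i. i \<in> A \<Longrightarrow> Ck_on k U (f i)"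
  shows "Ck_on k U (\<lambda>x. \<Sum>i\<in>A. f i x)"
  using assms(2)
  by (induction A rule: infinite_finite_induct) (auto simp: Ck_on_const intro: Ck_on_add[OF assms(1)])

lemma smooth_on_open_open: "smooth_on_open U f \<Longrightarrow> open U"
  by (simp add: smooth_on_open_def)

lemma smooth_on_open_cong:
  "\<lbrakk>smooth_on_open U f; \<And>x. x \<in> U \<Longrightarrow> f x = g x\<rbrakk> \<Longrightarrow> smooth_on_open U g"
  unfolding smooth_on_open_def using Ck_on_cong by blast

lemma smooth_on_open_subset:
  "\<lbrakk>smooth_on_open U f; open V; V \<subseteq> U\<rbrakk> \<Longrightarrow> smooth_on_open V f"
  unfolding smooth_on_open_def using Ck_on_subset by blast

lemma smooth_on_open_const: "open U \<Longrightarrow> smooth_on_open U (\<lambda>x. c)"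
  by (simp add: smooth_on_open_def Ck_on_const)

lemma smooth_on_open_linear: "open U \<Longrightarrow> bounded_linear f \<Longrightarrow> smooth_on_open U f"
  by (simp add: smooth_on_open_def Ck_on_linear)

lemma smooth_on_open_add:
  "\<lbrakk>smooth_on_open U f; smooth_on_open U g\<rbrakk> \<Longrightarrow> smooth_on_open U (\<lambda>x. f x + g x)"
  by (simp add: smooth_on_open_def Ck_on_add)

lemma smooth_on_open_bilinear:
  "\<lbrakk>bounded_bilinear h; smooth_on_open U f; smooth_on_open U g\<rbrakk>
    \<Longrightarrow> smooth_on_open U (\<lambda>x. h (f x) (g x))"
  by (simp add: smooth_on_open_def Ck_on_bilinear)

lemma smooth_on_open_sum:
  "\<lbrakk>open U; \<And>i. i \<in> A \<Longrightarrow> smooth_on_open U (f i)\<rbrakk> \<Longrightarrow> smooth_on_open U (\<lambda>x. \<Sum>i\<in>A. f i x)"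
  by (simp add: smooth_on_open_def Ck_on_sum)

lemma Ck_on_compose_linear:
  assumes "open U" "bounded_linear L" "Ck_on k U f"
  shows "Ck_on k U (\<lambda>x. L (f x))"
  using assms(3)
proof (induction k arbitrary: f)
  case 0
  then show ?case by (simp add: bounded_linear.continuous_on[OF assms(2)])
next
  case (Suc k)
  show ?case
    by (rule Ck_on_SucI[OF assms(1) bounded_linear.has_derivative[OF assms(2) has_derivative_frechet]])
       (use Suc in auto)
qed

lemma smooth_on_open_compose_linear:
  "\<lbrakk>bounded_linear L; smooth_on_open U f\<rbrakk> \<Longrightarrow> smooth_on_open U (\<lambda>x. L (f x))"
  by (simp add: smooth_on_open_def Ck_on_compose_linear)

lemma smooth_on_open_prod:
  fixes f :: "_ \<Rightarrow> _ \<Rightarrow> 'b::{real_normed_algebra_1, comm_ring_1}"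
  assumes "open U" "\<And>i. i \<in> A \<Longrightarrow> smooth_on_open U (f i)"
  shows "smooth_on_open U (\<lambda>x. \<Prod>i\<in>A. f i x)"
  using assms(2)
  by (induction A rule: infinite_finite_induct)
     (auto simp: smooth_on_open_const[OF assms(1)] intro: smooth_on_open_bilinear[OF bounded_bilinear_mult])

lemma smooth_on_open_vec:
  fixes f :: "'a::real_normed_vector \<Rightarrow> 'b::euclidean_space ^ 'n"
  assumes "open U" "\<And>i. smooth_on_open U (\<lambda>x. f x $ i)"
  shows "smooth_on_open U f"
proof -
  have "linear (axis i :: 'b \<Rightarrow> 'b ^ 'n)" for i
    by (rule linearI) (auto simp: axis_def vec_eq_iff)
  then have "smooth_on_open U (\<lambda>x. \<Sum>i\<in>UNIV. axis i (f x $ i))"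
    using assms by (intro smooth_on_open_sum smooth_on_open_compose_linear[of "axis _"])
      (auto simp: linear_conv_bounded_linear)
  moreover have "(\<Sum>i\<in>UNIV. axis i (f x $ i)) = f x" for x
    by (simp add: vec_eq_iff axis_def)
  ultimately show ?thesis by simp
qed

lemma smooth_on_open_has_derivative:
  "\<lbrakk>smooth_on_open U f; x \<in> U\<rbrakk> \<Longrightarrow> (f has_derivative frechet_derivative f (at x)) (at x)"
  unfolding smooth_on_open_def by (metis Ck_on.simps(2) has_derivative_frechet)

lemma smooth_on_open_frechet:
  "smooth_on_open U f \<Longrightarrow> smooth_on_open U (\<lambda>x. frechet_derivative f (at x) v)"
  unfolding smooth_on_open_def by (metis Ck_on.simps(2))

lemma linear_componentwise_expansion:
  fixes f :: "'a::euclidean_space \<Rightarrow> 'b::real_vector"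
  assumes "linear f"
  shows "f v = (\<Sum>b\<in>Basis. (v \<bullet> b) *\<^sub>R f b)"
  by (subst euclidean_representation[of v, symmetric])
     (simp only: linear_sum[OF assms] linear_cmul[OF assms])

text \<open>A Leibniz rule when smoothness in \<open>x\<close> is known only for each frozen
  argument. Expanding the argument in an orthonormal basis turns \<open>\<Phi> x (g x)\<close> into
  a finite sum of scalar functions times smooth maps. It is applied to the projections and to the
  differential of a smooth function.\<close>

lemma has_derivative_family:
  fixes \<Phi> :: "'a::real_normed_vector \<Rightarrow> 'c::euclidean_space \<Rightarrow> 'b::real_normed_vector"
  assumes lin: "\<And>x. x \<in> U \<Longrightarrow> linear (\<Phi> x)" and sm: "\<And>w. smooth_on_open U (\<lambda>x. \<Phi> x w)"
    and g: "(g has_derivative g') (at p)" and p: "p \<in> U"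
  shows "((\<lambda>x. \<Phi> x (g x)) has_derivative
    (\<lambda>v. \<Phi> p (g' v) + frechet_derivative (\<lambda>x. \<Phi> x (g p)) (at p) v)) (at p)"
proof -
  have U: "open U" using sm by (simp add: smooth_on_open_def)
  have ex: "(\<Sum>b\<in>Basis. (w \<bullet> b) *\<^sub>R \<Phi> x b) = \<Phi> x w" if "x \<in> U" for x w
    using linear_componentwise_expansion[OF lin[OF that]] by metis
  let ?D = "\<lambda>b. frechet_derivative (\<lambda>x. \<Phi> x b) (at p)"
  have D: "((\<lambda>x. \<Phi> x b) has_derivative ?D b) (at p)" for b
    by (rule smooth_on_open_has_derivative[OF sm p])
  have "((\<lambda>x. \<Sum>b\<in>Basis. (w \<bullet> b) *\<^sub>R \<Phi> x b) has_derivative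
      (\<lambda>v. \<Sum>b\<in>Basis. (w \<bullet> b) *\<^sub>R ?D b v)) (at p)" for w
    by (intro has_derivative_sum has_derivative_scaleR_right D)
  then have "((\<lambda>x. \<Phi> x w) has_derivative (\<lambda>v. \<Sum>b\<in>Basis. (w \<bullet> b) *\<^sub>R ?D b v)) (at p)" for w
    by (rule has_derivative_transform_within_open[OF _ U p]) (rule ex)
  then have 2: "?D w v = (\<Sum>b\<in>Basis. (w \<bullet> b) *\<^sub>R ?D b v)" for w v
    by (rule fun_cong[OF has_derivative_unique[OF D]])
  have "((\<lambda>x. \<Sum>b\<in>Basis. (g x \<bullet> b) *\<^sub>R \<Phi> x b) has_derivative
      (\<lambda>v. \<Sum>b\<in>Basis. (g p \<bullet> b) *\<^sub>R ?D b v + (g' v \<bullet> b) *\<^sub>R \<Phi> p b)) (at p)"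
    by (intro has_derivative_sum has_derivative_scaleR has_derivative_inner_left D g)
  then have "((\<lambda>x. \<Phi> x (g x)) has_derivative
      (\<lambda>v. \<Sum>b\<in>Basis. (g p \<bullet> b) *\<^sub>R ?D b v + (g' v \<bullet> b) *\<^sub>R \<Phi> p b)) (at p)"
    by (rule has_derivative_transform_within_open[OF _ U p]) (rule ex)
  then show ?thesis
    by (rule has_derivative_eq_rhs)
       (simp add: sum.distrib 2[of "g p"] ex[OF p] add.commute)
qed

lemma smooth_on_open_family:
  fixes \<Phi> :: "'a::real_normed_vector \<Rightarrow> 'c::euclidean_space \<Rightarrow> 'b::real_normed_vector"
  assumes lin: "\<And>x. x \<in> U \<Longrightarrow> linear (\<Phi> x)" and sm: "\<And>w. smooth_on_open U (\<lambda>x. \<Phi> x w)"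
    and g: "smooth_on_open U g"
  shows "smooth_on_open U (\<lambda>x. \<Phi> x (g x))"
proof (rule smooth_on_open_cong)
  show "smooth_on_open U (\<lambda>x. \<Sum>b\<in>Basis. (g x \<bullet> b) *\<^sub>R \<Phi> x b)"
    using g sm
    by (intro smooth_on_open_sum smooth_on_open_bilinear[OF bounded_bilinear_scaleR]
          smooth_on_open_compose_linear[OF bounded_linear_inner_left]) (auto simp: smooth_on_open_def)
  show "(\<Sum>b\<in>Basis. (g x \<bullet> b) *\<^sub>R \<Phi> x b) = \<Phi> x (g x)" if "x \<in> U" for x
    using linear_componentwise_expansion[OF lin[OF that]] by metis
qed

lemma linear_frechet_smooth: "\<lbrakk>smooth_on_open U f; x \<in> U\<rbrakk> \<Longrightarrow> linear (frechet_derivative f (at x))"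
  using smooth_on_open_has_derivative has_derivative_linear by blast

section \<open>Symmetry of second derivatives\<close>

lemma has_real_derivative_along:
  fixes F :: "'a::real_normed_vector \<Rightarrow> real"
  assumes "(F has_derivative F') (at (c + s *\<^sub>R v))"
  shows "((\<lambda>s. F (c + s *\<^sub>R v)) has_real_derivative F' v) (at s)"
proof -
  have "((\<lambda>s. c + s *\<^sub>R v) has_derivative (\<lambda>t. t *\<^sub>R v)) (at s)"
    by (auto intro!: derivative_eq_intros)
  from has_derivative_compose[OF this assms]
  have "((\<lambda>s. F (c + s *\<^sub>R v)) has_derivative (\<lambda>t. F' (t *\<^sub>R v))) (at s)" .
  moreover have "(\<lambda>t. F' (t *\<^sub>R v)) = (*) (F' v)"
    using linear_cmul[OF has_derivative_linear[OF assms]] by auto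
  ultimately show ?thesis by (simp add: has_field_derivative_def)
qed

text \<open>The mean value theorem, used first in direction \<open>v\<close> and then in direction
  \<open>w\<close>, makes the quotient equal to the second derivative at some intermediate point;
  continuity of that derivative finishes.\<close>

lemma second_difference_limit:
  fixes F :: "'a::real_normed_vector \<Rightarrow> real"
  assumes F: "smooth_on_open U F" and p: "p \<in> U"
  shows "((\<lambda>h. (F (p + h *\<^sub>R v + h *\<^sub>R w) - F (p + h *\<^sub>R v) - F (p + h *\<^sub>R w) + F p) / h\<^sup>2)
    \<longlongrightarrow> frechet_derivative (\<lambda>x. frechet_derivative F (at x) v) (at p) w) (at_right 0)"
    (is "(?\<Delta> \<longlongrightarrow> ?D2 p) _")
proof (rule tendstoI)
  let ?D = "\<lambda>x. frechet_derivative F (at x) v"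
  fix e :: real assume e: "e > 0"
  have U: "open U" using F by (simp add: smooth_on_open_def)
  have D: "smooth_on_open U ?D" by (rule smooth_on_open_frechet[OF F])
  have "continuous_on U ?D2"
    using smooth_on_open_frechet[OF D, of w] unfolding smooth_on_open_def by (metis Ck_on.simps(1))
  then have "isCont ?D2 p" using U p by (simp add: continuous_on_eq_continuous_at)
  then obtain d1 where d1: "d1 > 0" "\<And>x. dist x p < d1 \<Longrightarrow> dist (?D2 x) (?D2 p) < e"
    using e unfolding continuous_at_eps_delta by blast
  obtain d2 where d2: "d2 > 0" "ball p d2 \<subseteq> U" using U p open_contains_ball by blast
  \<comment> \<open>For \<open>h < d\<close> the whole parallelogram with sides \<open>h v\<close>
    and \<open>h w\<close> stays within \<open>min d1 d2\<close> of \<open>p\<close>; the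
    \<open>+ 1\<close> keeps the denominator positive when both vectors vanish.\<close>
  define d where "d = min d1 d2 / (norm v + norm w + 1)"
  have nz: "norm v + norm w + 1 > 0" by (smt (verit) norm_ge_zero)
  have d: "d > 0" unfolding d_def using d1 d2 nz by simp
  have near: "dist (p + s *\<^sub>R v + t *\<^sub>R w) p < min d1 d2"
    if "\<bar>s\<bar> \<le> h" "\<bar>t\<bar> \<le> h" "0 < h" "h < d" for s t h
  proof -
    have "dist (p + s *\<^sub>R v + t *\<^sub>R w) p \<le> \<bar>s\<bar> * norm v + \<bar>t\<bar> * norm w"
      by (simp add: dist_norm norm_triangle_le)
    also have "\<dots> \<le> h * norm v + h * norm w" using that by (intro add_mono mult_right_mono) auto
    also have "\<dots> \<le> h * (norm v + norm w + 1)" using that by (simp add: algebra_simps)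
    also have "\<dots> < d * (norm v + norm w + 1)" using that nz by (intro mult_strict_right_mono) auto
    also have "\<dots> = min d1 d2" unfolding d_def using nz by simp
    finally show ?thesis .
  qed
  have "dist (?\<Delta> h) (?D2 p) < e" if h: "0 < h" "h < d" for h
  proof -
    let ?u = "\<lambda>s. F (p + s *\<^sub>R v + h *\<^sub>R w) - F (p + s *\<^sub>R v)"
    have inU: "p + s *\<^sub>R v + t *\<^sub>R w \<in> U" if "0 \<le> s" "s \<le> h" "0 \<le> t" "t \<le> h" for s t
      using near[of s h t] that h d2(2) by (auto simp: dist_commute subset_iff)
    have dF: "((\<lambda>s. F (p + s *\<^sub>R v + t *\<^sub>R w)) has_real_derivative ?D (p + s *\<^sub>R v + t *\<^sub>R w)) (at s)"
      if "0 \<le> s" "s \<le> h" "0 \<le> t" "t \<le> h" for s t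
      using has_real_derivative_along[of F _ "p + t *\<^sub>R w" s v]
        smooth_on_open_has_derivative[OF F inU[OF that]] by (simp add: add_ac)
    have du: "(?u has_real_derivative
        (?D (p + s *\<^sub>R v + h *\<^sub>R w) - ?D (p + s *\<^sub>R v))) (at s)" if "0 \<le> s" "s \<le> h" for s
      using DERIV_diff[OF dF[of s h] dF[of s 0]] that h by simp
    obtain s where s: "0 < s" "s < h"
      "?u h - ?u 0 = (h - 0) * (?D (p + s *\<^sub>R v + h *\<^sub>R w) - ?D (p + s *\<^sub>R v))"
      using MVT2[of 0 h ?u, OF h(1) du] by blast
    have dD: "((\<lambda>t. ?D (p + s *\<^sub>R v + t *\<^sub>R w)) has_real_derivative ?D2 (p + s *\<^sub>R v + t *\<^sub>R w)) (at t)"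
      if "0 \<le> t" "t \<le> h" for t
    proof -
      have "p + s *\<^sub>R v + t *\<^sub>R w \<in> U" using inU that s by simp
      then show ?thesis
        by (rule has_real_derivative_along[OF smooth_on_open_has_derivative[OF D]])
    qed
    obtain t where t: "0 < t" "t < h"
      "?D (p + s *\<^sub>R v + h *\<^sub>R w) - ?D (p + s *\<^sub>R v + 0 *\<^sub>R w) = (h - 0) * ?D2 (p + s *\<^sub>R v + t *\<^sub>R w)"
      using MVT2[of 0 h "\<lambda>t. ?D (p + s *\<^sub>R v + t *\<^sub>R w)", OF h(1) dD] by blast
    have "?\<Delta> h = ?D2 (p + s *\<^sub>R v + t *\<^sub>R w)"
      using s(3) t(3) h by (simp add: power2_eq_square field_simps)
    then show ?thesis using d1(2) near[of s h t] s t h by simp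
  qed
  then show "\<forall>\<^sub>F h in at_right 0. dist (?\<Delta> h) (?D2 p) < e"
    unfolding eventually_at_right_field using d by blast
qed

text \<open>The second difference quotient does not change when \<open>v\<close> and
  \<open>w\<close> are exchanged, and limits are unique.\<close>

lemma frechet_second_symmetric:
  fixes F :: "'a::real_normed_vector \<Rightarrow> real"
  assumes "smooth_on_open U F" "p \<in> U"
  shows "frechet_derivative (\<lambda>x. frechet_derivative F (at x) v) (at p) w =
    frechet_derivative (\<lambda>x. frechet_derivative F (at x) w) (at p) v"
proof (rule tendsto_unique[OF _ second_difference_limit[OF assms]])
  show "((\<lambda>h. (F (p + h *\<^sub>R v + h *\<^sub>R w) - F (p + h *\<^sub>R v) - F (p + h *\<^sub>R w) + F p) / h\<^sup>2)
    \<longlongrightarrow> frechet_derivative (\<lambda>x. frechet_derivative F (at x) w) (at p) v) (at_right 0)"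
    using second_difference_limit[OF assms, of w v] by (simp add: algebra_simps)
qed simp

section \<open>Derivatives along a submanifold\<close>

text \<open>A counterpart of \<open>mdiff\<close> with values in any normed space, so that vector
  fields can be differentiated along the manifold too.\<close>

definition mderiv :: "'e::euclidean_space set \<Rightarrow> ('e \<Rightarrow> 'b::real_normed_vector) \<Rightarrow> 'e \<Rightarrow> 'e \<Rightarrow> 'b" where
  "mderiv M f p v =
     (THE d. \<forall>c. curve_with_velocity M p v c \<longrightarrow> ((\<lambda>t. f (c t)) has_vector_derivative d) (at 0))"

lemma mdiff_eq_mderiv: "mdiff M f p v = mderiv M f p v"
  by (simp add: mdiff_def mderiv_def has_real_derivative_iff_has_vector_derivative)

text \<open>The curve stays in \<open>M\<close>, so it cannot distinguish \<open>f\<close> from a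
  differentiable extension \<open>g\<close>; the chain rule for \<open>g\<close> therefore computes
  the derivative of \<open>f\<close>.\<close>

lemma curve_chain:
  assumes c: "curve_with_velocity M p v c"
    and U: "open U" "p \<in> U" and g: "(g has_derivative g') (at p)"
    and eq: "\<And>x. x \<in> U \<inter> M \<Longrightarrow> g x = f x"
  shows "((\<lambda>t. f (c t)) has_vector_derivative g' v) (at 0)"
proof -
  from c obtain e where e: "e > 0" "smooth_on_open {-e<..<e} c" "c ` {-e<..<e} \<subseteq> M"
    and c0: "c 0 = p" and dc: "(c has_derivative (\<lambda>t. t *\<^sub>R v)) (at 0)"
    unfolding curve_with_velocity_def has_vector_derivative_def by blast
  have "continuous_on {-e<..<e} c"
    using e(2) unfolding smooth_on_open_def by (metis Ck_on.simps(1))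
  then have op: "open ({-e<..<e} \<inter> c -` U)"
    by (rule continuous_open_preimage) (auto simp: U)
  have "((\<lambda>t. g (c t)) has_derivative (\<lambda>t. g' (t *\<^sub>R v))) (at 0)"
    using has_derivative_compose[OF dc, of g g'] g c0 by simp
  moreover have "g' (t *\<^sub>R v) = t *\<^sub>R g' v" for t
    using linear_cmul[OF has_derivative_linear[OF g]] .
  ultimately have "((\<lambda>t. g (c t)) has_derivative (\<lambda>t. t *\<^sub>R g' v)) (at 0)" by simp
  then have "((\<lambda>t. f (c t)) has_derivative (\<lambda>t. t *\<^sub>R g' v)) (at 0)"
    by (rule has_derivative_transform_within_open[OF _ op]) (use e c0 U eq in \<open>auto simp: image_subset_iff\<close>)
  then show ?thesis by (simp add: has_vector_derivative_def)
qed

text \<open>The description in \<open>mderiv\<close> is met by the chain rule for every curve. It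
  determines the value because a tangent vector has at least one curve.\<close>

lemma mderiv_eqI:
  assumes v: "v \<in> tangent_space M p"
    and "open U" "p \<in> U" "(g has_derivative g') (at p)" "\<And>x. x \<in> U \<inter> M \<Longrightarrow> g x = f x"
  shows "mderiv M f p v = g' v"
  unfolding mderiv_def
proof (rule the_equality)
  show *: "\<forall>c. curve_with_velocity M p v c \<longrightarrow> ((\<lambda>t. f (c t)) has_vector_derivative g' v) (at 0)"
    using curve_chain assms(2-) by blast
  obtain c where "curve_with_velocity M p v c" using v by (auto simp: tangent_space_def)
  then show "d = g' v" if "\<forall>c. curve_with_velocity M p v c \<longrightarrow>
      ((\<lambda>t. f (c t)) has_vector_derivative d) (at 0)" for d
    using that * vector_derivative_unique_at by blast
qed

lemma mderiv_smooth:
  assumes "v \<in> tangent_space M p" "smooth_on_open U g" "p \<in> U" "\<And>x. x \<in> U \<inter> M \<Longrightarrow> g x = f x"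
  shows "mderiv M f p v = frechet_derivative g (at p) v"
  using assms(2)
  by (intro mderiv_eqI[OF assms(1) _ assms(3) smooth_on_open_has_derivative[OF assms(2,3)] assms(4)])
     (auto simp: smooth_on_open_def)

lemma smooth_mapE:
  assumes "smooth_map M f" "p \<in> M"
  obtains U g where "p \<in> U" "smooth_on_open U g" "\<And>x. x \<in> U \<Longrightarrow> x \<in> M \<Longrightarrow> g x = f x"
  proof -
  obtain U g where "p \<in> U" "smooth_on_open U g" "\<forall>x\<in>U \<inter> M. g x = f x"
    using assms unfolding smooth_map_def by meson
  then show thesis by (intro that[of U g]) auto
qed

lemma curve_mderiv:
  assumes "smooth_map M f" "p \<in> M" "curve_with_velocity M p v c"
  shows "((\<lambda>t. f (c t)) has_vector_derivative mderiv M f p v) (at 0)"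
proof -
  obtain U g where g: "p \<in> U" "smooth_on_open U g" "\<And>x. x \<in> U \<inter> M \<Longrightarrow> g x = f x"
    using smooth_mapE[OF assms(1,2)] by (metis IntE)
  moreover have "v \<in> tangent_space M p" using assms by (auto simp: tangent_space_def)
  ultimately show ?thesis
    using curve_chain[OF assms(3) _ g(1) smooth_on_open_has_derivative[OF g(2,1)] g(3)]
      mderiv_smooth[of v M p U g f] by (simp add: smooth_on_open_def)
qed

lemma smooth_mapI:
  assumes "\<And>p. p \<in> M \<Longrightarrow> \<exists>U g. p \<in> U \<and> smooth_on_open U g \<and> (\<forall>x\<in>U \<inter> M. g x = f x)"
  shows "smooth_map M f"
  using assms by (simp add: smooth_map_def)

lemma smooth_map_global: "smooth_on_open UNIV f \<Longrightarrow> smooth_map M f"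
  by (rule smooth_mapI) blast

lemma smooth_map_pairE:
  assumes "smooth_map M f" "smooth_map M g" "p \<in> M"
  obtains U F G where "p \<in> U" "smooth_on_open U F" "smooth_on_open U G"
    "\<And>x. x \<in> U \<Longrightarrow> x \<in> M \<Longrightarrow> F x = f x" "\<And>x. x \<in> U \<Longrightarrow> x \<in> M \<Longrightarrow> G x = g x"
proof -
  obtain U F where F: "p \<in> U" "smooth_on_open U F" "\<And>x. x \<in> U \<Longrightarrow> x \<in> M \<Longrightarrow> F x = f x"
    using smooth_mapE[OF assms(1,3)] by metis
  obtain W G where G: "p \<in> W" "smooth_on_open W G" "\<And>x. x \<in> W \<Longrightarrow> x \<in> M \<Longrightarrow> G x = g x"
    using smooth_mapE[OF assms(2,3)] by metis
  have "open (U \<inter> W)" using F(2) G(2) by (auto simp: smooth_on_open_def)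
  then show thesis
    using F G by (intro that[of "U \<inter> W" F G]) (auto intro: smooth_on_open_subset)
qed

lemma smooth_map_cong: "\<lbrakk>smooth_map M f; \<And>x. x \<in> M \<Longrightarrow> f x = g x\<rbrakk> \<Longrightarrow> smooth_map M g"
  unfolding smooth_map_def by (metis IntD2)

lemma smooth_map_bilinear:
  assumes "bounded_bilinear h" "smooth_map M f" "smooth_map M g"
  shows "smooth_map M (\<lambda>x. h (f x) (g x))"
proof (rule smooth_mapI)
  fix p assume "p \<in> M"
  then obtain U F G where "p \<in> U" "smooth_on_open U F" "smooth_on_open U G"
    "\<And>x. x \<in> U \<Longrightarrow> x \<in> M \<Longrightarrow> F x = f x" "\<And>x. x \<in> U \<Longrightarrow> x \<in> M \<Longrightarrow> G x = g x"
    using smooth_map_pairE[OF assms(2,3)] by metis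
  then show "\<exists>U k. p \<in> U \<and> smooth_on_open U k \<and> (\<forall>x\<in>U \<inter> M. k x = h (f x) (g x))"
    using smooth_on_open_bilinear[OF assms(1)] by (intro exI[of _ U] exI[of _ "\<lambda>x. h (F x) (G x)"]) auto
qed

lemma mderiv_bilinear:
  assumes "bounded_bilinear h" "smooth_map M f" "smooth_map M g" "p \<in> M" "v \<in> tangent_space M p"
  shows "mderiv M (\<lambda>x. h (f x) (g x)) p v = h (f p) (mderiv M g p v) + h (mderiv M f p v) (g p)"
proof -
  obtain U F G where F: "p \<in> U" "smooth_on_open U F" "smooth_on_open U G"
    "\<And>x. x \<in> U \<Longrightarrow> x \<in> M \<Longrightarrow> F x = f x" "\<And>x. x \<in> U \<Longrightarrow> x \<in> M \<Longrightarrow> G x = g x"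
    using smooth_map_pairE[OF assms(2-4)] by metis
  have "mderiv M (\<lambda>x. h (f x) (g x)) p v =
      h (F p) (frechet_derivative G (at p) v) + h (frechet_derivative F (at p) v) (G p)"
    using F by (intro mderiv_eqI[OF assms(5) _ F(1) bounded_bilinear.FDERIV[OF assms(1)
        smooth_on_open_has_derivative[OF F(2,1)] smooth_on_open_has_derivative[OF F(3,1)]]]) (auto simp: smooth_on_open_def)
  then show ?thesis
    using F assms(4) mderiv_smooth[OF assms(5) F(2,1)] mderiv_smooth[OF assms(5) F(3,1)] by simp
qed

lemma mderiv_add:
  assumes "smooth_map M f" "smooth_map M g" "p \<in> M" "v \<in> tangent_space M p"
  shows "mderiv M (\<lambda>x. f x + g x) p v = mderiv M f p v + mderiv M g p v"
proof -
  obtain U F G where F: "p \<in> U" "smooth_on_open U F" "smooth_on_open U G"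
    "\<And>x. x \<in> U \<Longrightarrow> x \<in> M \<Longrightarrow> F x = f x" "\<And>x. x \<in> U \<Longrightarrow> x \<in> M \<Longrightarrow> G x = g x"
    using smooth_map_pairE[OF assms(1-3)] by metis
  have "mderiv M (\<lambda>x. f x + g x) p v = frechet_derivative F (at p) v + frechet_derivative G (at p) v"
    using F by (intro mderiv_eqI[OF assms(4) _ F(1) has_derivative_add[OF
        smooth_on_open_has_derivative[OF F(2,1)] smooth_on_open_has_derivative[OF F(3,1)]]]) (auto simp: smooth_on_open_def)
  then show ?thesis
    using F mderiv_smooth[OF assms(4) F(2,1)] mderiv_smooth[OF assms(4) F(3,1)] by simp
qed

lemma mderiv_linear:
  assumes f: "smooth_map M f" and p: "p \<in> M"
    and vw: "v \<in> tangent_space M p" "w \<in> tangent_space M p" "a *\<^sub>R v + b *\<^sub>R w \<in> tangent_space M p"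
  shows "mderiv M f p (a *\<^sub>R v + b *\<^sub>R w) = a *\<^sub>R mderiv M f p v + b *\<^sub>R mderiv M f p w"
proof -
  obtain U g where g: "p \<in> U" "smooth_on_open U g" "\<And>x. x \<in> U \<Longrightarrow> x \<in> M \<Longrightarrow> g x = f x"
    using smooth_mapE[OF f p] by metis
  then have "mderiv M f p u = frechet_derivative g (at p) u" if "u \<in> tangent_space M p" for u
    using mderiv_smooth[OF that g(2,1), of f] by simp
  then show ?thesis
    using vw linear_add[OF linear_frechet_smooth[OF g(2,1)]]
      linear_cmul[OF linear_frechet_smooth[OF g(2,1)]] by simp
qed

text \<open>Difference quotients lie in \<open>V\<close>, and a subspace of a Euclidean space is
  closed. With \<open>V\<close> the zero space this also differentiates equations that hold along a
  curve.\<close>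

lemma has_vector_derivative_in_subspace:
  fixes f :: "real \<Rightarrow> 'a::euclidean_space"
  assumes V: "subspace V" and f: "(f has_vector_derivative d) (at 0)"
    and ev: "0 < e" "\<And>t. \<bar>t\<bar> < e \<Longrightarrow> f t \<in> V"
  shows "d \<in> V"
proof (rule Lim_in_closed_set[OF closed_subspace[OF V]])
  show "((\<lambda>t. (f (0 + t) - f 0) /\<^sub>R t) \<longlongrightarrow> d) (at 0)"
  proof -
    have "norm ((f x - f 0) /\<^sub>R x - d) = norm (f x - f 0 - x *\<^sub>R d) / \<bar>x\<bar>" if "x \<noteq> 0" for x
    proof -
      have "(f x - f 0) /\<^sub>R x - d = (f x - f 0 - x *\<^sub>R d) /\<^sub>R x" using that by (simp add: algebra_simps)
      then show ?thesis by (simp add: divide_inverse mult.commute)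
    qed
    then show ?thesis
      using f unfolding has_vector_derivative_def has_derivative_at' LIM_eq by simp
  qed
  show "\<forall>\<^sub>F t in at 0. (f (0 + t) - f 0) /\<^sub>R t \<in> V"
    unfolding eventually_at using ev V
    by (intro exI[of _ e]) (auto intro!: subspace_scale subspace_diff)
qed simp

lemma affine_connection_tangent:
  "\<lbrakk>affine_connection M nab; p \<in> M; v \<in> tangent_space M p; smooth_field M Y\<rbrakk>
    \<Longrightarrow> nab p v Y \<in> tangent_space M p"
  unfolding affine_connection_def by meson

section \<open>Submanifolds with a smooth family of tangent projections\<close>

text \<open>The last assumption is the symmetry of the second fundamental form, in terms of the
  derivative of the projection.\<close>

locale projected_submanifold =
  fixes M :: "'e::euclidean_space set" and V :: "'e set" and \<pi> :: "'e \<Rightarrow> 'e \<Rightarrow> 'e"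
  assumes subspace_V: "subspace V"
    and tangent_eq: "p \<in> M \<Longrightarrow> tangent_space M p = {v \<in> V. \<pi> p v = v}"
    and \<pi>_V: "p \<in> M \<Longrightarrow> v \<in> V \<Longrightarrow> \<pi> p v \<in> V"
    and \<pi>_idem: "p \<in> M \<Longrightarrow> v \<in> V \<Longrightarrow> \<pi> p (\<pi> p v) = \<pi> p v"
    and \<pi>_inner: "p \<in> M \<Longrightarrow> v \<in> V \<Longrightarrow> w \<in> V \<Longrightarrow> \<pi> p v \<bullet> w = v \<bullet> \<pi> p w"
    and linear_\<pi>: "linear (\<pi> p)"
    and smooth_\<pi>: "smooth_on_open UNIV (\<lambda>p. \<pi> p v)"
    and \<pi>_symmetric: "p \<in> M \<Longrightarrow> v \<in> tangent_space M p \<Longrightarrow> w \<in> tangent_space M p \<Longrightarrow>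
      frechet_derivative (\<lambda>q. \<pi> q w) (at p) v = frechet_derivative (\<lambda>q. \<pi> q v) (at p) w"
begin

abbreviation T where "T \<equiv> tangent_space M"

lemma \<pi>_tangent: "p \<in> M \<Longrightarrow> v \<in> V \<Longrightarrow> \<pi> p v \<in> T p"
  by (simp add: tangent_eq \<pi>_V \<pi>_idem)

lemma \<pi>_fix: "p \<in> M \<Longrightarrow> v \<in> T p \<Longrightarrow> \<pi> p v = v"
  by (simp add: tangent_eq)

lemma T_V: "p \<in> M \<Longrightarrow> v \<in> T p \<Longrightarrow> v \<in> V"
  by (simp add: tangent_eq)

lemma subspace_T: "p \<in> M \<Longrightarrow> subspace (T p)"
  using subspace_V linear_\<pi>[of p] unfolding subspace_def
  by (auto simp: tangent_eq linear_0 linear_add linear_cmul)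

lemma \<pi>_inner_tangent: "p \<in> M \<Longrightarrow> v \<in> V \<Longrightarrow> w \<in> T p \<Longrightarrow> \<pi> p v \<bullet> w = v \<bullet> w"
  by (simp add: \<pi>_inner tangent_eq)

lemma smooth_\<pi>_along: "smooth_on_open U h \<Longrightarrow> smooth_on_open U (\<lambda>x. \<pi> x (h x))"
  by (rule smooth_on_open_family[OF linear_\<pi>])
     (auto intro: smooth_on_open_subset[OF smooth_\<pi>] dest: smooth_on_open_open)

lemma has_derivative_\<pi>_along:
  "(h has_derivative h') (at p) \<Longrightarrow> ((\<lambda>x. \<pi> x (h x)) has_derivative
    (\<lambda>v. \<pi> p (h' v) + frechet_derivative (\<lambda>x. \<pi> x (h p)) (at p) v)) (at p)"
  by (rule has_derivative_family[OF linear_\<pi> smooth_\<pi>]) auto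

text \<open>The map \<open>\<pi> p\<close> is assumed to be an orthogonal projection only on
  \<open>V\<close>, so a derivative must be known to lie in \<open>V\<close> before it is
  projected.\<close>

lemma mderiv_V:
  assumes "smooth_map M Y" "\<And>q. q \<in> M \<Longrightarrow> Y q \<in> V" "p \<in> M" "v \<in> T p"
  shows "mderiv M Y p v \<in> V"
proof -
  obtain c where c: "curve_with_velocity M p v c" using assms(4) by (auto simp: tangent_space_def)
  then obtain e where e: "e > 0" "c ` {-e<..<e} \<subseteq> M" unfolding curve_with_velocity_def by blast
  have "Y (c t) \<in> V" if "\<bar>t\<bar> < e" for t
  proof -
    have "t \<in> {-e<..<e}" using that by auto
    then show ?thesis using e(2) assms(2) by blast
  qed
  then show ?thesis
    by (rule has_vector_derivative_in_subspace[OF subspace_V curve_mderiv[OF assms(1,3) c] e(1)])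
qed

lemma smooth_field_V: "smooth_field M Y \<Longrightarrow> q \<in> M \<Longrightarrow> Y q \<in> V"
  using T_V[of q "Y q"] by (simp add: smooth_field_def)

lemma field_mderiv_V: "smooth_field M Y \<Longrightarrow> p \<in> M \<Longrightarrow> v \<in> T p \<Longrightarrow> mderiv M Y p v \<in> V"
  using mderiv_V[of Y p v] smooth_field_V[of Y] by (simp add: smooth_field_def)

text \<open>Projecting the constant field \<open>v\<close> extends a tangent vector to the whole
  manifold at once.\<close>

lemma field_through:
  assumes "p \<in> M" "v \<in> T p"
  obtains X where "smooth_field M X" "X p = v"
proof
  show "smooth_field M (\<lambda>q. \<pi> q v)"
    using T_V[OF assms] by (simp add: smooth_field_def \<pi>_tangent smooth_map_global smooth_\<pi>)
qed (use assms \<pi>_fix in auto)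

text \<open>Differentiating \<open>Y = \<pi> Y\<close> shows that the normal part of \<open>D\<^sub>X Y\<close> is symmetric
  in \<open>X\<close> and \<open>Y\<close>.\<close>

lemma bracket_tangent:
  assumes X: "smooth_field M X" and Y: "smooth_field M Y" and p: "p \<in> M"
  shows "mderiv M Y p (X p) - mderiv M X p (Y p) \<in> T p"
proof -
  have split: "mderiv M Z p v = \<pi> p (mderiv M Z p v) + frechet_derivative (\<lambda>x. \<pi> x (Z p)) (at p) v"
    if Z: "smooth_field M Z" and v: "v \<in> T p" for Z v
  proof -
    obtain U g where g: "p \<in> U" "smooth_on_open U g" "\<And>x. x \<in> U \<Longrightarrow> x \<in> M \<Longrightarrow> g x = Z x"
      using smooth_mapE Z p unfolding smooth_field_def by metis
    have "mderiv M Z p v =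
        \<pi> p (frechet_derivative g (at p) v) + frechet_derivative (\<lambda>x. \<pi> x (g p)) (at p) v"
      using g Z by (intro mderiv_eqI[OF v _ g(1) has_derivative_\<pi>_along]
          smooth_on_open_has_derivative[OF g(2,1)])
        (auto simp: smooth_on_open_def smooth_field_def \<pi>_fix)
    then show ?thesis using mderiv_smooth[OF v g(2,1), of Z] g p by simp
  qed
  have t: "X p \<in> T p" "Y p \<in> T p" using X Y p by (auto simp: smooth_field_def)
  have "\<pi> p (mderiv M Y p (X p) - mderiv M X p (Y p)) = mderiv M Y p (X p) - mderiv M X p (Y p)"
    using split[OF X t(2)] split[OF Y t(1)] \<pi>_symmetric[OF p t]
    by (simp add: linear_diff[OF linear_\<pi>]) (metis add_diff_cancel_right)
  moreover have "mderiv M Y p (X p) - mderiv M X p (Y p) \<in> V"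
    using X Y p t by (intro subspace_diff[OF subspace_V] field_mderiv_V)
  ultimately show ?thesis using p by (simp add: tangent_eq)
qed

section \<open>The projected connection and its axioms\<close>

definition proj_connection :: "'e \<Rightarrow> 'e \<Rightarrow> ('e \<Rightarrow> 'e) \<Rightarrow> 'e" where
  "proj_connection p v Y = \<pi> p (mderiv M Y p v)"

lemma proj_connection_tangent:
  "\<lbrakk>smooth_field M Y; p \<in> M; v \<in> T p\<rbrakk> \<Longrightarrow> proj_connection p v Y \<in> T p"
  by (simp add: proj_connection_def \<pi>_tangent field_mderiv_V)

lemma smooth_field_proj_connection:
  assumes X: "smooth_field M X" and Y: "smooth_field M Y"
  shows "smooth_field M (\<lambda>p. proj_connection p (X p) Y)"
  unfolding smooth_field_def
proof (intro conjI ballI smooth_mapI)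
  fix p assume p: "p \<in> M"
  show "proj_connection p (X p) Y \<in> T p"
    using X Y p by (auto intro: proj_connection_tangent simp: smooth_field_def)
  have "smooth_map M X" "smooth_map M Y" using X Y by (auto simp: smooth_field_def)
  then obtain U F G where F: "p \<in> U" "smooth_on_open U F" "smooth_on_open U G"
    "\<And>x. x \<in> U \<Longrightarrow> x \<in> M \<Longrightarrow> F x = X x" "\<And>x. x \<in> U \<Longrightarrow> x \<in> M \<Longrightarrow> G x = Y x"
    using smooth_map_pairE[OF _ _ p] by metis
  show "\<exists>U g. p \<in> U \<and> smooth_on_open U g \<and> (\<forall>x\<in>U \<inter> M. g x = proj_connection x (X x) Y)"
  proof (intro exI conjI ballI)
    \<comment> \<open>Replacing both fields by local extensions \<open>F\<close> and
      \<open>G\<close> gives a formula that also makes sense off \<open>M\<close>, because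
      \<open>\<pi>\<close> is smooth everywhere.\<close>
    show "smooth_on_open U (\<lambda>x. \<pi> x (frechet_derivative G (at x) (F x)))"
      by (rule smooth_\<pi>_along[OF smooth_on_open_family[OF
            linear_frechet_smooth[OF F(3)] smooth_on_open_frechet[OF F(3)] F(2)]])
    fix x assume x: "x \<in> U \<inter> M"
    then have "mderiv M Y x (X x) = frechet_derivative G (at x) (X x)"
      using X F by (intro mderiv_smooth[of _ M x U]) (auto simp: smooth_field_def)
    then show "\<pi> x (frechet_derivative G (at x) (F x)) = proj_connection x (X x) Y"
      using x F by (simp add: proj_connection_def)
  qed (rule F)
qed

lemma affine_connection_proj: "affine_connection M proj_connection"
  unfolding affine_connection_def
proof (intro conjI allI impI ballI)
  show "smooth_field M (\<lambda>p. proj_connection p (X p) Y)" if "smooth_field M X \<and> smooth_field M Y" for X Y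
    using that smooth_field_proj_connection by blast
next
  fix p v Y assume p: "p \<in> M" and v: "v \<in> T p" and Y: "smooth_field M Y"
  then have sY: "smooth_map M Y" by (simp add: smooth_field_def)
  show "proj_connection p v Y \<in> T p" using p v Y by (intro proj_connection_tangent)
  show "proj_connection p (a *\<^sub>R v + b *\<^sub>R w) Y = a *\<^sub>R proj_connection p v Y + b *\<^sub>R proj_connection p w Y"
    if w: "w \<in> T p" for w a b
  proof -
    have "a *\<^sub>R v + b *\<^sub>R w \<in> T p"
      using v w subspace_T[OF p] by (simp add: subspace_add subspace_scale)
    then show ?thesis
      using mderiv_linear[OF sY p v w] unfolding proj_connection_def
      by (simp add: linear_add[OF linear_\<pi>] linear_cmul[OF linear_\<pi>])
  qed
  show "proj_connection p v (\<lambda>q. Y q + Z q) = proj_connection p v Y + proj_connection p v Z"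
    if Z: "smooth_field M Z" for Z
    using mderiv_add[OF sY _ p v, of Z] Z
    by (simp add: proj_connection_def linear_add[OF linear_\<pi>] smooth_field_def)
  show "proj_connection p v (\<lambda>q. f q *\<^sub>R Y q) = mdiff M f p v *\<^sub>R Y p + f p *\<^sub>R proj_connection p v Y"
    if f: "smooth_map M f" for f :: "'e \<Rightarrow> real"
    using mderiv_bilinear[OF bounded_bilinear_scaleR f sY p v] Y p
    by (simp add: proj_connection_def linear_add[OF linear_\<pi>] linear_cmul[OF linear_\<pi>]
        mdiff_eq_mderiv smooth_field_def \<pi>_fix add.commute)
qed

text \<open>The product rule for the inner product holds in the ambient space, and projecting one
  factor does not alter its inner product with a tangent vector.\<close>

lemma metric_compatible_proj: "metric_compatible M proj_connection"
  unfolding metric_compatible_def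
proof (intro ballI allI impI)
  fix p v Y Z assume p: "p \<in> M" and v: "v \<in> T p" and YZ: "smooth_field M Y \<and> smooth_field M Z"
  then have "smooth_map M Y" "smooth_map M Z" "Y p \<in> T p" "Z p \<in> T p" by (auto simp: smooth_field_def)
  moreover have "mderiv M Y p v \<in> V" "mderiv M Z p v \<in> V" using YZ p v by (auto intro: field_mderiv_V)
  ultimately show "mdiff M (\<lambda>q. Y q \<bullet> Z q) p v = proj_connection p v Y \<bullet> Z p + Y p \<bullet> proj_connection p v Z"
    using mderiv_bilinear[OF bounded_bilinear_inner _ _ p v, of Y Z] p
    by (simp add: mdiff_eq_mderiv proj_connection_def \<pi>_inner_tangent inner_commute[of "Y p"])
qed

text \<open>In the commutator of the two derivations the second derivatives of \<open>f\<close>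
  cancel by symmetry. What remains is \<open>f\<close> differentiated along the ambient bracket,
  which is tangent and so unaffected by the projection.\<close>

lemma torsion_free_proj: "torsion_free M proj_connection"
  unfolding torsion_free_def
proof (intro ballI allI impI)
  fix X Y and f :: "'e \<Rightarrow> real" and p assume XY: "smooth_field M X \<and> smooth_field M Y" and f: "smooth_map M f" and p: "p \<in> M"
  obtain U1 F where F1: "p \<in> U1" "smooth_on_open U1 F" "\<And>x. x \<in> U1 \<Longrightarrow> x \<in> M \<Longrightarrow> F x = f x"
    using smooth_mapE[OF f p] by metis
  have "smooth_map M X" "smooth_map M Y" using XY by (auto simp: smooth_field_def)
  then obtain U2 h g where hg: "p \<in> U2" "smooth_on_open U2 h" "smooth_on_open U2 g"
    "\<And>x. x \<in> U2 \<Longrightarrow> x \<in> M \<Longrightarrow> h x = X x" "\<And>x. x \<in> U2 \<Longrightarrow> x \<in> M \<Longrightarrow> g x = Y x"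
    using smooth_map_pairE[OF _ _ p] by metis
  define U where "U = U1 \<inter> U2"
  have opU: "open U" using F1 hg by (auto simp: U_def smooth_on_open_def)
  have pU: "p \<in> U" using F1 hg by (simp add: U_def)
  have F: "smooth_on_open U F" and h: "smooth_on_open U h" and g: "smooth_on_open U g"
    using F1(2) hg(2,3) opU by (auto intro: smooth_on_open_subset simp: U_def)
  let ?DF = "\<lambda>x. frechet_derivative F (at x)"
  have df: "mdiff M f q v = ?DF q v" if "q \<in> U" "v \<in> T q" for q v
    unfolding mdiff_eq_mderiv using that F F1(3) by (intro mderiv_smooth[of v M q U F]) (auto simp: U_def)
  have second: "mdiff M (\<lambda>q. mdiff M f q (Z q)) p v =
      ?DF p (mderiv M Z p v) + frechet_derivative (\<lambda>x. ?DF x (Z p)) (at p) v"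
    if Z: "smooth_field M Z" and k: "smooth_on_open U k" "\<And>x. x \<in> U \<Longrightarrow> x \<in> M \<Longrightarrow> k x = Z x"
      and v: "v \<in> T p" for Z k v
  proof -
    have "mderiv M (\<lambda>q. mdiff M f q (Z q)) p v =
        ?DF p (frechet_derivative k (at p) v) + frechet_derivative (\<lambda>x. ?DF x (k p)) (at p) v"
    proof (rule mderiv_eqI[OF v opU pU has_derivative_family[OF _ _ _ pU]])
      show "linear (?DF x)" if "x \<in> U" for x by (rule linear_frechet_smooth[OF F that])
      show "smooth_on_open U (\<lambda>x. ?DF x w)" for w by (rule smooth_on_open_frechet[OF F])
      show "(k has_derivative frechet_derivative k (at p)) (at p)"
        by (rule smooth_on_open_has_derivative[OF k(1) pU])
      show "?DF x (k x) = mdiff M f x (Z x)" if "x \<in> U \<inter> M" for x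
        using that k(2) df Z by (auto simp: smooth_field_def)
    qed
    then show ?thesis
      using mderiv_smooth[OF v k(1) pU, of Z] k(2) pU p by (simp add: mdiff_eq_mderiv)
  qed
  have t: "X p \<in> T p" "Y p \<in> T p" using XY p by (auto simp: smooth_field_def)
  let ?B = "mderiv M Y p (X p) - mderiv M X p (Y p)"
  have B: "?B \<in> T p" using bracket_tangent XY p by blast
  then have "proj_connection p (X p) Y - proj_connection p (Y p) X = ?B"
    using \<pi>_fix[OF p B] by (simp add: proj_connection_def linear_diff[OF linear_\<pi>])
  then have "mdiff M f p (proj_connection p (X p) Y - proj_connection p (Y p) X) = ?DF p ?B"
    using df pU B by simp
  also have "\<dots> = ?DF p (mderiv M Y p (X p)) - ?DF p (mderiv M X p (Y p))"
    by (rule linear_diff[OF linear_frechet_smooth[OF F pU]])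
  also have "\<dots> = mdiff M (\<lambda>q. mdiff M f q (Y q)) p (X p) - mdiff M (\<lambda>q. mdiff M f q (X q)) p (Y p)"
    using second[OF _ g _ t(1), of Y] second[OF _ h _ t(2), of X] hg(4,5) XY
      frechet_second_symmetric[OF F pU, of "X p" "Y p"] by (simp add: U_def)
  finally show "mdiff M f p (proj_connection p (X p) Y - proj_connection p (Y p) X) =
      mdiff M (\<lambda>q. mdiff M f q (Y q)) p (X p) - mdiff M (\<lambda>q. mdiff M f q (X q)) p (Y p)" .
qed

lemma is_levi_civita_proj: "is_levi_civita M proj_connection"
  by (simp add: is_levi_civita_def affine_connection_proj metric_compatible_proj torsion_free_proj)

text \<open>The difference of two Levi-Civita connections is symmetric in its first two and
  antisymmetric in its last two arguments, hence zero.\<close>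

lemma levi_civita_unique:
  assumes N: "is_levi_civita M nab" and N': "is_levi_civita M nab'"
    and p: "p \<in> M" and v: "v \<in> T p" and Y: "smooth_field M Y"
  shows "nab p v Y = nab' p v Y"
proof -
  have tan: "nab p w Z \<in> T p" "nab' p w Z \<in> T p" if "w \<in> T p" "smooth_field M Z" for w Z
    using affine_connection_tangent[OF _ p that] N N' by (auto simp: is_levi_civita_def)
  have at: "X p \<in> T p" if "smooth_field M X" for X using that p by (simp add: smooth_field_def)
  \<comment> \<open>Torsion-freeness is stated through derivations; the linear functions
    \<open>q \<bullet> u\<close> suffice to recover inner products of tangent vectors from
    it.\<close>
  have md: "mdiff M (\<lambda>q. q \<bullet> u) p w = w \<bullet> u" if "w \<in> T p" for u w
    unfolding mdiff_eq_mderiv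
    by (rule mderiv_eqI[OF that, of UNIV "\<lambda>q. q \<bullet> u" "\<lambda>w. w \<bullet> u"]) (auto intro!: derivative_eq_intros)
  have sm: "smooth_map M (\<lambda>q. q \<bullet> u)" for u
    by (intro smooth_map_global smooth_on_open_linear bounded_linear_inner_left) auto
  define S where "S X Y Z = (nab p (X p) Y - nab' p (X p) Y) \<bullet> Z p" for X Y Z
  have anti: "S X Y Z = - S X Z Y" if "smooth_field M X" "smooth_field M Y" "smooth_field M Z" for X Y Z
  proof -
    have "mdiff M (\<lambda>q. Y q \<bullet> Z q) p (X p) = nb p (X p) Y \<bullet> Z p + Y p \<bullet> nb p (X p) Z"
      if "is_levi_civita M nb" for nb
      using that p at[OF \<open>smooth_field M X\<close>] \<open>smooth_field M Y\<close> \<open>smooth_field M Z\<close>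
      unfolding is_levi_civita_def metric_compatible_def by blast
    from this[OF N] this[OF N']
    have "nab p (X p) Y \<bullet> Z p + Y p \<bullet> nab p (X p) Z = nab' p (X p) Y \<bullet> Z p + Y p \<bullet> nab' p (X p) Z"
      by simp
    then show ?thesis by (simp add: S_def inner_diff_left inner_commute[of "Y p"])
  qed
  have sym: "S X Y Z = S Y X Z" if XY: "smooth_field M X" "smooth_field M Y" for X Y Z
  proof -
    have "(nab p (X p) Y - nab p (Y p) X) \<bullet> Z p = (nab' p (X p) Y - nab' p (Y p) X) \<bullet> Z p"
    proof -
      have "nab p (X p) Y - nab p (Y p) X \<in> T p" "nab' p (X p) Y - nab' p (Y p) X \<in> T p"
        using XY at tan by (auto intro: subspace_diff[OF subspace_T[OF p]])
      moreover have "mdiff M (\<lambda>q. q \<bullet> Z p) p (nb p (X p) Y - nb p (Y p) X) =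
          mdiff M (\<lambda>q. mdiff M (\<lambda>q. q \<bullet> Z p) q (Y q)) p (X p) -
          mdiff M (\<lambda>q. mdiff M (\<lambda>q. q \<bullet> Z p) q (X q)) p (Y p)"
        if "is_levi_civita M nb" for nb
        using that p XY sm[of "Z p"] unfolding is_levi_civita_def torsion_free_def by blast
      from this[OF N] this[OF N']
      have "mdiff M (\<lambda>q. q \<bullet> Z p) p (nab p (X p) Y - nab p (Y p) X) =
          mdiff M (\<lambda>q. q \<bullet> Z p) p (nab' p (X p) Y - nab' p (Y p) X)" by simp
      ultimately show ?thesis by (simp add: md)
    qed
    then show ?thesis by (simp add: S_def inner_diff_left)
  qed
  obtain X where X: "smooth_field M X" "X p = v" using field_through[OF p v] .
  \<comment> \<open>Taking \<open>Z\<close> through the difference itself turns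
    \<open>S X Y Z\<close> into a squared norm.\<close>
  have "nab p v Y - nab' p v Y \<in> T p" using tan[OF v Y] subspace_diff[OF subspace_T[OF p]] by blast
  then obtain Z where Z: "smooth_field M Z" "Z p = nab p v Y - nab' p v Y" using field_through[OF p] by blast
  \<comment> \<open>Alternating the two symmetries permutes the three fields back to the starting
    order with an odd number of sign changes.\<close>
  have "S X Y Z = - S X Y Z"
  proof -
    have "S X Y Z = - S Z X Y" using anti[OF X(1) Y Z(1)] sym[OF X(1) Z(1)] by simp
    also have "\<dots> = S Y Z X" using anti[OF Z(1) X(1) Y] sym[OF Z(1) Y] by simp
    also have "\<dots> = - S X Y Z" using anti[OF Y Z(1) X(1)] sym[OF Y X(1)] by simp
    finally show ?thesis .
  qed
  then have "Z p \<bullet> Z p = 0" using X(2) Z(2) by (simp add: S_def)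
  then show ?thesis using Z(2) by simp
qed

lemma is_levi_civita_levi_civita: "is_levi_civita M (levi_civita M)"
  unfolding levi_civita_def by (rule someI[of "is_levi_civita M", OF is_levi_civita_proj])

lemma levi_civita_eq:
  "\<lbrakk>p \<in> M; v \<in> T p; smooth_field M Y\<rbrakk> \<Longrightarrow> levi_civita M p v Y = \<pi> p (mderiv M Y p v)"
  using levi_civita_unique[OF is_levi_civita_levi_civita is_levi_civita_proj]
  by (simp add: proj_connection_def)

section \<open>Gradient and Hessian of a function from a global extension of its gradient\<close>

context
  fixes f :: "'e \<Rightarrow> real" and G :: "'e \<Rightarrow> 'e"
  assumes smooth_f: "smooth_on_open UNIV f" and smooth_G: "smooth_on_open UNIV G"
    and G_tangent: "\<And>q. q \<in> M \<Longrightarrow> G q \<in> T q"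
    and G_deriv: "\<And>q v. q \<in> M \<Longrightarrow> v \<in> T q \<Longrightarrow> frechet_derivative f (at q) v = G q \<bullet> v"
begin

lemma mdiff_grad: "q \<in> M \<Longrightarrow> v \<in> T q \<Longrightarrow> mdiff M f q v = G q \<bullet> v"
  using mderiv_smooth[of v M q UNIV f f] smooth_f by (simp add: mdiff_eq_mderiv G_deriv)

lemma riem_grad_eq:
  assumes "q \<in> M" shows "riem_grad M f q = G q"
  unfolding riem_grad_def
proof (rule the_equality)
  show "G q \<in> T q \<and> (\<forall>v\<in>T q. mdiff M f q v = G q \<bullet> v)"
    using assms G_tangent mdiff_grad by blast
  fix g assume g: "g \<in> T q \<and> (\<forall>v\<in>T q. mdiff M f q v = g \<bullet> v)"
  then have "G q - g \<in> T q" using subspace_diff[OF subspace_T[OF assms]] G_tangent assms by blast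
  then have "(G q - g) \<bullet> (G q - g) = 0"
    using g mdiff_grad[OF assms] by (metis inner_diff_left diff_self)
  then show "g = G q" by simp
qed

lemma smooth_field_riem_grad: "smooth_field M (riem_grad M f)"
  unfolding smooth_field_def
  using smooth_map_cong[OF smooth_map_global[OF smooth_G], of M "riem_grad M f"]
    riem_grad_eq G_tangent by auto

text \<open>The gradient is meaningful only on \<open>M\<close>. Its smooth extension
  \<open>G\<close> has the same derivative in tangent directions, so ordinary differentiation of
  \<open>G\<close> is enough.\<close>

lemma riem_hessian_eq:
  assumes p: "p \<in> M" and v: "v \<in> T p"
  shows "riem_hessian M f p v = \<pi> p (frechet_derivative G (at p) v)"
  unfolding riem_hessian_def levi_civita_eq[OF p v smooth_field_riem_grad]
  using mderiv_smooth[OF v smooth_G, of "riem_grad M f"] riem_grad_eq by simp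

text \<open>Extend \<open>v\<close> and \<open>w\<close> to fields \<open>X\<close> and
  \<open>Z\<close>. Metric compatibility writes the Hessian form as the derivative along
  \<open>v\<close> of \<open>Z f\<close>, minus the differential of \<open>f\<close> on the
  covariant derivative of \<open>Z\<close> along \<open>v\<close>. Torsion-freeness says exactly
  that this is symmetric in the two fields.\<close>

lemma self_adjoint_riem_hessian:
  assumes p: "p \<in> M"
  shows "self_adjoint_on (T p) (riem_hessian M f p)"
proof -
  let ?Y = "riem_grad M f" and ?N = "levi_civita M"
  note Y = smooth_field_riem_grad
  have aff: "affine_connection M ?N" and met: "metric_compatible M ?N" and tor: "torsion_free M ?N"
    using is_levi_civita_levi_civita by (auto simp: is_levi_civita_def)
  have tan: "?N p v Z \<in> T p" if "v \<in> T p" "smooth_field M Z" for v Z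
    using affine_connection_tangent[OF aff p that] .
  have lin: "?N p (a *\<^sub>R v + b *\<^sub>R w) ?Y = a *\<^sub>R ?N p v ?Y + b *\<^sub>R ?N p w ?Y"
    if "v \<in> T p" "w \<in> T p" for v w a b
    using aff[unfolded affine_connection_def, THEN conjunct2, rule_format, OF p that(1) Y] that(2)
    by blast
  have sf: "smooth_map M f" by (rule smooth_map_global[OF smooth_f])
  have "?N p v ?Y \<bullet> w = v \<bullet> ?N p w ?Y" if v: "v \<in> T p" and w: "w \<in> T p" for v w
  proof -
    obtain X where X: "smooth_field M X" "X p = v" using field_through[OF p v] .
    obtain Z where Z: "smooth_field M Z" "Z p = w" using field_through[OF p w] .
    \<comment> \<open>The two functions coincide only on \<open>M\<close>, so both derivatives are
      computed from one common extension \<open>g\<close>.\<close>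
    have "mdiff M (\<lambda>q. ?Y q \<bullet> K q) p u = mdiff M (\<lambda>q. mdiff M f q (K q)) p u"
      if K: "smooth_field M K" and u: "u \<in> T p" for K u
    proof -
      have "smooth_map M (\<lambda>q. ?Y q \<bullet> K q)"
        using Y K by (intro smooth_map_bilinear[OF bounded_bilinear_inner]) (auto simp: smooth_field_def)
      then obtain U g where g: "p \<in> U" "smooth_on_open U g" "\<And>x. x \<in> U \<Longrightarrow> x \<in> M \<Longrightarrow> g x = ?Y x \<bullet> K x"
        using smooth_mapE p by blast
      have "?Y x \<bullet> K x = mdiff M f x (K x)" if "x \<in> M" for x
        using that K mdiff_grad riem_grad_eq by (simp add: smooth_field_def)
      then show ?thesis
        using g mderiv_smooth[OF u g(2,1), of "\<lambda>q. ?Y q \<bullet> K q"]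
          mderiv_smooth[OF u g(2,1), of "\<lambda>q. mdiff M f q (K q)"] by (simp add: mdiff_eq_mderiv)
    qed
    then have mt: "mdiff M (\<lambda>q. mdiff M f q (K q)) p u = ?N p u ?Y \<bullet> K p + ?Y p \<bullet> ?N p u K"
      if "smooth_field M K" "u \<in> T p" for K u
    proof -
      have "mdiff M (\<lambda>q. ?Y q \<bullet> K q) p u = ?N p u ?Y \<bullet> K p + ?Y p \<bullet> ?N p u K"
        using met p Y that unfolding metric_compatible_def by blast
      then show ?thesis
        using \<open>\<And>u K. \<lbrakk>smooth_field M K; u \<in> T p\<rbrakk> \<Longrightarrow> mdiff M (\<lambda>q. ?Y q \<bullet> K q) p u =
          mdiff M (\<lambda>q. mdiff M f q (K q)) p u\<close>[OF that] by simp
    qed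
    have "mdiff M f p (?N p v Z - ?N p w X) =
        mdiff M (\<lambda>q. mdiff M f q (Z q)) p v - mdiff M (\<lambda>q. mdiff M f q (X q)) p w"
      using tor sf p X Z unfolding torsion_free_def by blast
    moreover have "mdiff M f p (?N p v Z - ?N p w X) = ?Y p \<bullet> (?N p v Z - ?N p w X)"
      using mdiff_grad[OF p] riem_grad_eq[OF p] tan[OF v Z(1)] tan[OF w X(1)]
        subspace_diff[OF subspace_T[OF p]] by metis
    ultimately show ?thesis
      using mt[OF Z(1) v] mt[OF X(1) w] X(2) Z(2) by (simp add: inner_diff_right inner_commute)
  qed
  then show ?thesis
    unfolding self_adjoint_on_def riem_hessian_def using tan Y lin by auto
qed

end

end

section \<open>Complex matrices\<close>

lemma bounded_bilinear_matrix_mult: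
  "bounded_bilinear ((**) :: complex^'n::finite^'m::finite \<Rightarrow> complex^'p::finite^'n \<Rightarrow> complex^'p^'m)"
  unfolding bilinear_conv_bounded_bilinear[symmetric] bilinear_def
  by (auto intro!: linearI
      simp: vec_eq_iff matrix_matrix_mult_def algebra_simps sum.distrib scaleR_sum_right)

interpretation mm: bounded_bilinear "(**) :: complex^'n::finite^'n \<Rightarrow> complex^'n^'n \<Rightarrow> complex^'n^'n"
  by (rule bounded_bilinear_matrix_mult)

lemma bounded_bilinear_ad: "bounded_bilinear (ad :: complex^'n::finite^'n \<Rightarrow> _)"
  unfolding bilinear_conv_bounded_bilinear[symmetric] bilinear_def
  by (auto intro!: linearI simp: ad_def mm.add_left mm.add_right mm.scaleR_left mm.scaleR_right
      scaleR_diff_right)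

interpretation ad: bounded_bilinear "ad :: complex^'n::finite^'n \<Rightarrow> complex^'n^'n \<Rightarrow> complex^'n^'n"
  by (rule bounded_bilinear_ad)

lemma bounded_linear_dagger: "bounded_linear (dagger :: complex^'n::finite^'n \<Rightarrow> _)"
  unfolding linear_conv_bounded_linear[symmetric]
  by (rule linearI) (auto simp: dagger_def vec_eq_iff scaleR_complex.ctr complex_eq_iff)

lemma dagger_mult: "dagger (X ** Y) = dagger Y ** dagger X"
  by (simp add: dagger_def vec_eq_iff matrix_matrix_mult_def mult.commute)

lemma dagger_dagger [simp]: "dagger (dagger X) = X"
  by (simp add: dagger_def vec_eq_iff)

lemmas dagger_diff = linear_diff[OF bounded_linear.linear[OF bounded_linear_dagger]]

lemmas dagger_add = linear_add[OF bounded_linear.linear[OF bounded_linear_dagger]]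

text \<open>The simplifier collects equal summands \<open>X + X\<close> to \<open>2 * X\<close>.\<close>

lemma matrix_mult_two [simp]:
  fixes X Y :: "complex^'n::finite^'n"
  shows "X ** (2 * Y) = 2 * (X ** Y)" "(2 * X) ** Y = 2 * (X ** Y)" "dagger (2 * X) = 2 * dagger X"
  by (simp_all only: mult_2 mm.add_left mm.add_right dagger_add)

lemma inner_matrix_trace: "X \<bullet> Y = Re (trace (dagger X ** Y))" for X Y :: "complex^'n::finite^'n"
  unfolding trace_def matrix_matrix_mult_def dagger_def inner_vec_def
  by (simp add: inner_complex_def) (rule sum.swap)

lemma cmats_mult: "\<lbrakk>X \<in> cmats S; Y \<in> cmats S\<rbrakk> \<Longrightarrow> X ** Y \<in> cmats S"
  unfolding cmats_def matrix_matrix_mult_def by (auto intro!: sum.neutral)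

lemma subspace_cmats: "subspace (cmats S)"
  by (auto simp: subspace_def cmats_def)

lemma subspace_her: "subspace (her S)"
  using subspace_cmats[of S]
  by (auto simp: subspace_def her_def dagger_add
      linear_cmul[OF bounded_linear.linear[OF bounded_linear_dagger]]
      linear_0[OF bounded_linear.linear[OF bounded_linear_dagger]])

lemma subspace_her_prod: "subspace (her_prod I)"
  using subspace_her by (auto simp: subspace_def her_prod_def)

lemma cmats_ad: "\<lbrakk>X \<in> cmats S; Y \<in> cmats S\<rbrakk> \<Longrightarrow> ad X Y \<in> cmats S"
  unfolding ad_def by (intro subspace_diff[OF subspace_cmats] cmats_mult)

text \<open>For Hermitian \<open>P\<close>, \<open>ad P\<close> exchanges Hermitian and
  skew-Hermitian matrices, so its square preserves the Hermitian ones.\<close>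

lemma her_ad_ad: "\<lbrakk>P \<in> her S; X \<in> her S\<rbrakk> \<Longrightarrow> ad P (ad P X) \<in> her S"
  unfolding her_def by (auto simp: cmats_ad) (simp add: ad_def dagger_diff dagger_add dagger_mult mm.diff_left mm.diff_right mm.add_left mm.add_right matrix_mul_assoc)

lemma ad_jacobi: "ad X (ad Z Y) - ad Y (ad Z X) = ad Z (ad X Y)" for X Y Z :: "complex^'n::finite^'n"
  by (simp add: ad_def mm.diff_left mm.diff_right mm.add_left mm.add_right matrix_mul_assoc)

text \<open>Below, \<open>P ** X + X ** P = X\<close> is the equation of the tangent space at a projection \<open>P\<close>;
  it says that \<open>X\<close> is block off-diagonal.\<close>

context
  fixes P :: "complex^'n::finite^'n"
  assumes P: "P ** P = P"
begin

lemma idem_absorb: "P ** (P ** X) = P ** X" "X ** P ** P = X ** P"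
  using P by (metis matrix_mul_assoc)+

text \<open>In the block form given by \<open>P\<close>, \<open>ad P\<close> multiplies the diagonal
  blocks by 0 and the two off-diagonal blocks by 1 and -1; hence its cube is itself.\<close>

lemma ad_ad_ad: "ad P (ad P (ad P X)) = ad P X"
  unfolding ad_def
  by (simp add: mm.diff_left mm.diff_right mm.add_left mm.add_right matrix_mul_assoc[symmetric] idem_absorb P)

text \<open>Multiplying the hypothesis by \<open>P\<close> on both sides counts the block
  \<open>P X P\<close> twice on the left and once on the right.\<close>

lemma off_diagonal_sandwich:
  assumes "P ** X + X ** P = X"
  shows "P ** (X ** P) = 0"
proof -
  have "P ** X ** P + P ** (X ** P) = P ** (X ** P)"
    using arg_cong[OF assms, of "\<lambda>Z. P ** (Z ** P)"]
    by (simp add: mm.add_left mm.add_right matrix_mul_assoc[symmetric] idem_absorb P)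
  then show ?thesis by (simp add: matrix_mul_assoc)
qed

lemma ad_ad_fixed_iff: "ad P (ad P X) = X \<longleftrightarrow> P ** X + X ** P = X"
proof
  assume "P ** X + X ** P = X"
  then show "ad P (ad P X) = X"
    using off_diagonal_sandwich[of X]
    by (simp add: ad_def mm.diff_left mm.diff_right mm.add_left mm.add_right matrix_mul_assoc[symmetric] idem_absorb P)
next
  assume X: "ad P (ad P X) = X"
  have "P ** ad P (ad P X) + ad P (ad P X) ** P = ad P (ad P X)"
    by (simp add: ad_def mm.diff_left mm.diff_right mm.add_left mm.add_right matrix_mul_assoc[symmetric] idem_absorb P)
  then show "P ** X + X ** P = X" using X by simp
qed

text \<open>A product of two block off-diagonal matrices is block diagonal, and such matrices
  commute with \<open>P\<close>.\<close>

lemma off_diagonal_mult_commute: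
  assumes X: "P ** X + X ** P = X" and Y: "P ** Y + Y ** P = Y"
  shows "P ** (X ** Y) = X ** Y ** P"
proof -
  have "P ** (X ** Y) = P ** (X ** (P ** Y)) + P ** (X ** (Y ** P))"
    by (subst (1) Y[symmetric]) (simp add: mm.add_right)
  also have "P ** (X ** (P ** Y)) = 0"
    using off_diagonal_sandwich[OF X] by (metis matrix_mul_assoc mm.zero_left)
  finally have 1: "P ** (X ** Y) = P ** (X ** (Y ** P))" by simp
  have "X ** Y ** P = P ** (X ** (Y ** P)) + X ** (P ** (Y ** P))"
    by (subst (1) X[symmetric]) (simp add: mm.add_left matrix_mul_assoc[symmetric])
  also have "X ** (P ** (Y ** P)) = 0"
    using off_diagonal_sandwich[OF Y] by simp
  finally show ?thesis using 1 by simp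
qed

lemma ad_ad_off_diagonal:
  assumes X: "P ** X + X ** P = X" and Y: "P ** Y + Y ** P = Y"
  shows "ad P (ad X Y) = 0"
  using off_diagonal_mult_commute[OF X Y] off_diagonal_mult_commute[OF Y X]
  by (simp add: ad_def[of P] ad_def[of X] mm.diff_left mm.diff_right mm.add_left mm.add_right)

lemma off_diagonal_ad: "P ** ad P X + ad P X ** P = ad P X"
  by (simp add: ad_def mm.diff_left mm.diff_right mm.add_left mm.add_right matrix_mul_assoc[symmetric] idem_absorb P)

text \<open>By Jacobi the two leading terms differ by \<open>ad P (ad X Y)\<close>, and every term
  of this kind vanishes. This gives the symmetry of the second fundamental form, component by
  component.\<close>

lemma ad_second_symmetric:
  assumes X: "P ** X + X ** P = X" and Y: "P ** Y + Y ** P = Y"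
  shows "ad X (ad P Y) + ad P (ad X Y) = ad Y (ad P X) + ad P (ad Y X)"
  using ad_jacobi[of X P Y] ad_ad_off_diagonal[OF X Y] ad_ad_off_diagonal[OF Y X] by simp

end

section \<open>Componentwise derivatives and linear differential equations\<close>

lemma has_derivative_vec:
  fixes f :: "'a::real_normed_vector \<Rightarrow> 'b::euclidean_space ^ 'n"
  assumes "\<And>i. ((\<lambda>x. f x $ i) has_derivative (\<lambda>v. f' v $ i)) (at x)"
  shows "(f has_derivative f') (at x)"
  unfolding has_derivative_componentwise_within[of f]
  using has_derivative_inner_left[OF assms] by (auto simp: Basis_vec_def inner_axis)

lemma has_vector_derivative_vec:
  fixes f :: "real \<Rightarrow> 'b::euclidean_space ^ 'n"
  shows "(f has_vector_derivative f') (at t) \<longleftrightarrow> (\<forall>i. ((\<lambda>t. f t $ i) has_vector_derivative f' $ i) (at t))"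
  unfolding has_vector_derivative_def
  by (auto intro!: has_derivative_vec bounded_linear.has_derivative[OF bounded_linear_vec_nth, of f "\<lambda>t. t *\<^sub>R f'", simplified])

text \<open>\<open>U t\<close> is the exponential of \<open>t B\<close>, built entry by entry from
  the scalar power series with coefficients \<open>c a b k\<close>, the entries of \<open>B\<close>
  to the power \<open>k\<close> divided by \<open>fact k\<close>.\<close>

lemma matrix_exponential:
  fixes B :: "complex^'n::finite^'n"
  obtains U :: "real \<Rightarrow> complex^'n^'n"
  where "U 0 = mat 1" "\<And>t. (U has_vector_derivative B ** U t) (at t)"
proof -
  define p :: "nat \<Rightarrow> complex^'n^'n" where "p k = (((**) B) ^^ k) (mat 1)" for k
  define c where "c a b k = p k $ a $ b /\<^sub>R fact k" for a b k
  \<comment> \<open>\<open>K\<close> bounds left multiplication by \<open>B\<close>, so the powers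
    of \<open>B\<close> grow at most geometrically and a real exponential series dominates each
    entry.\<close>
  obtain K where K: "K > 0" "\<And>X :: complex^'n^'n. norm (B ** X) \<le> norm X * K"
    using bounded_linear.pos_bounded[OF bounded_bilinear.bounded_linear_right[OF bounded_bilinear_matrix_mult, of B]]
    by blast
  have pn: "norm (p k) \<le> norm (mat 1 :: complex^'n^'n) * K ^ k" for k
  proof (induction k)
    case (Suc k)
    have "norm (p (Suc k)) \<le> norm (p k) * K" using K(2)[of "p k"] by (simp add: p_def)
    also have "\<dots> \<le> norm (mat 1 :: complex^'n^'n) * K ^ k * K" using Suc K(1) by (intro mult_right_mono) auto
    finally show ?case by (simp add: mult_ac)
  qed (simp add: p_def)
  have sm: "summable (\<lambda>k. c a b k * z ^ k)" for a b z
  proof (rule summable_comparison_test')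
    show "summable (\<lambda>k. norm (mat 1 :: complex^'n^'n) * ((K * norm z) ^ k /\<^sub>R fact k))"
      by (intro summable_mult summable_exp_generic)
    show "norm (c a b k * z ^ k) \<le> norm (mat 1 :: complex^'n^'n) * ((K * norm z) ^ k /\<^sub>R fact k)"
      if "0 \<le> k" for k
    proof -
      have "norm (p k $ a $ b) \<le> norm (mat 1 :: complex^'n^'n) * K ^ k"
        using Finite_Cartesian_Product.norm_nth_le[of "p k $ a" b] Finite_Cartesian_Product.norm_nth_le[of "p k" a] pn[of k] by linarith
      then have "norm (p k $ a $ b) * (norm z ^ k / fact k)
          \<le> norm (mat 1 :: complex^'n^'n) * K ^ k * (norm z ^ k / fact k)"
        by (intro mult_right_mono) auto
      then show ?thesis
        by (simp add: c_def norm_mult norm_power power_mult_distrib divide_inverse mult_ac)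
    qed
  qed
  \<comment> \<open>The factor \<open>k + 1\<close> from differentiation reduces the factorial,
    leaving one more factor \<open>B\<close>: this is the differential equation at the level of
    coefficients.\<close>
  have dc: "diffs (c a b) k = (\<Sum>d\<in>UNIV. B $ a $ d * c d b k)" for a b k
  proof -
    have "diffs (c a b) k = p (Suc k) $ a $ b /\<^sub>R fact k"
      by (simp add: diffs_def c_def scaleR_conv_of_real del: of_nat_Suc)
    also have "\<dots> = (\<Sum>d\<in>UNIV. B $ a $ d * c d b k)"
      by (simp add: p_def c_def matrix_matrix_mult_def scaleR_sum_right)
    finally show ?thesis .
  qed
  define U :: "real \<Rightarrow> complex^'n^'n" where "U t = (\<chi> a b. \<Sum>k. c a b k * of_real t ^ k)" for t
  show thesis
  proof
    show "U 0 = mat 1"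
      by (simp only: U_def of_real_0 powser_zero) (simp add: c_def p_def)
  next
    fix t
    have "((\<lambda>t. \<Sum>k. c a b k * of_real t ^ k) has_vector_derivative (B ** U t) $ a $ b) (at t)" for a b
    proof -
      have "((\<lambda>x. \<Sum>k. c a b k * x ^ k) has_field_derivative
          (\<Sum>k. diffs (c a b) k * of_real t ^ k)) (at (of_real t))"
        by (rule termdiffs_strong_converges_everywhere[OF sm])
      moreover have "(\<Sum>k. diffs (c a b) k * of_real t ^ k) = (B ** U t) $ a $ b"
      proof -
        have "(\<Sum>k. diffs (c a b) k * of_real t ^ k) =
            (\<Sum>k. \<Sum>d\<in>UNIV. B $ a $ d * (c d b k * of_real t ^ k))"
          by (simp add: dc sum_distrib_right mult.assoc)
        also have "\<dots> = (\<Sum>d\<in>UNIV. \<Sum>k. B $ a $ d * (c d b k * of_real t ^ k))"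
          by (rule suminf_sum) (rule summable_mult[OF sm])
        also have "\<dots> = (\<Sum>d\<in>UNIV. B $ a $ d * (\<Sum>k. c d b k * of_real t ^ k))"
          by (rule sum.cong[OF refl], rule suminf_mult[OF sm])
        finally show ?thesis by (simp add: matrix_matrix_mult_def U_def)
      qed
      \<comment> \<open>The series was differentiated in a complex variable; restriction to the real
        axis gives the derivative in \<open>t\<close>.\<close>
      ultimately show ?thesis using has_vector_derivative_real_field by fastforce
    qed
    then show "(U has_vector_derivative B ** U t) (at t)"
      by (simp add: has_vector_derivative_vec U_def)
  qed
qed

text \<open>Bootstrapping: the derivative \<open>L (W t)\<close> is as smooth as \<open>W\<close>,
  so each order of smoothness yields the next.\<close>

lemma smooth_linear_ode:
  fixes W :: "real \<Rightarrow> 'a::real_normed_vector"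
  assumes L: "bounded_linear L" and W: "\<And>t. (W has_vector_derivative L (W t)) (at t)"
  shows "smooth_on_open UNIV W"
proof -
  have "Ck_on k UNIV W" for k
  proof (induction k)
    case 0
    show ?case
      using W by (auto intro!: continuous_at_imp_continuous_on has_vector_derivative_continuous)
  next
    case (Suc k)
    show ?case
    proof (rule Ck_on_SucI[OF open_UNIV])
      show "(W has_derivative (\<lambda>s. s *\<^sub>R L (W t))) (at t)" for t
        using W unfolding has_vector_derivative_def .
      show "Ck_on k UNIV (\<lambda>t. v *\<^sub>R L (W t))" for v
        by (rule Ck_on_compose_linear[OF open_UNIV _ Suc])
           (rule bounded_linear_compose[OF bounded_linear_scaleR_right L])
    qed
  qed
  then show ?thesis by (simp add: smooth_on_open_def)
qed

lemma constant_if_derivative_zero: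
  fixes f :: "real \<Rightarrow> 'a::real_normed_vector"
  assumes "\<And>t. (f has_vector_derivative 0) (at t)"
  shows "f t = f 0"
proof -
  have "\<exists>c. \<forall>t\<in>UNIV. f t = c"
    by (rule has_derivative_zero_constant) (use assms in \<open>auto simp: has_vector_derivative_def\<close>)
  then show ?thesis by auto
qed

section \<open>The product of Grassmannians\<close>

lemma grassmannD:
  assumes "P \<in> grassmann S m"
  shows "P ** P = P" "dagger P = P" "P \<in> cmats S" "P \<in> her S"
  using assms by (auto simp: grassmann_def her_def)

text \<open>The curve through \<open>P\<close> with velocity \<open>X\<close> is the orbit of \<open>P\<close> under the one-parameter
  group of unitaries generated by \<open>[X, P]\<close>, written as \<open>W W\<^sup>\<dagger>\<close> with \<open>W = U P\<close>.\<close>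

lemma grassmann_curve:
  assumes P: "P \<in> grassmann S m" and X: "X \<in> her S" "P ** X + X ** P = X"
  obtains W where "smooth_on_open UNIV W" "\<And>t. W t ** dagger (W t) \<in> grassmann S m"
    "W 0 ** dagger (W 0) = P" "((\<lambda>t. W t ** dagger (W t)) has_vector_derivative X) (at 0)"
proof -
  note Pf = grassmannD[OF P]
  define B where "B = ad X P"
  have B: "dagger B = - B" "B \<in> cmats S"
    using X(1) Pf by (auto simp: B_def ad_def dagger_diff dagger_mult her_def
        intro!: subspace_diff[OF subspace_cmats] cmats_mult)
  obtain U where U: "U 0 = mat 1" "\<And>t. (U has_vector_derivative B ** U t) (at t)"
    using matrix_exponential[of B] by metis
  define W where "W t = U t ** P" for t
  have W': "(W has_vector_derivative B ** W t) (at t)" for t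
    unfolding W_def matrix_mul_assoc
    by (rule bounded_linear.has_vector_derivative[OF mm.bounded_linear_left U(2)])
  have dW': "((\<lambda>t. dagger (W t)) has_vector_derivative - (dagger (W t) ** B)) (at t)" for t
    using bounded_linear.has_vector_derivative[OF bounded_linear_dagger W'[of t]]
    by (simp add: dagger_mult B mm.minus_right)
  have W0: "W 0 = P" using U(1) by (simp add: W_def)
  have WP: "W t ** P = W t" for t by (simp add: W_def idem_absorb[OF Pf(1)])
  \<comment> \<open>Since \<open>B\<close> is skew-Hermitian this product is conserved. It takes the
    place of unitarity of \<open>U\<close> and later yields both idempotence and, by cyclicity, the
    trace.\<close>
  have WW: "dagger (W t) ** W t = P" for t
  proof -
    have "((\<lambda>t. dagger (W t) ** W t) has_vector_derivative
        dagger (W t) ** (B ** W t) + - (dagger (W t) ** B) ** W t) (at t)" for t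
      by (rule mm.has_vector_derivative[OF dW' W'])
    then have "((\<lambda>t. dagger (W t) ** W t) has_vector_derivative 0) (at t)" for t
      by (simp add: mm.minus_left matrix_mul_assoc)
    then have "dagger (W t) ** W t = dagger (W 0) ** W 0" by (rule constant_if_derivative_zero)
    then show ?thesis using Pf W0 by simp
  qed
  \<comment> \<open>Rows of \<open>B\<close> outside \<open>S\<close> vanish, so those rows of
    \<open>W\<close> stay at their initial value 0. In \<open>W ** dagger W\<close> this clears the
    rows and the columns outside \<open>S\<close>.\<close>
  have rows: "W t $ a $ b = 0" if "a \<notin> S" for t a b
  proof -
    have "((\<lambda>t. W t $ a $ b) has_vector_derivative (B ** W t) $ a $ b) (at t)" for t
      using W' by (simp add: has_vector_derivative_vec)
    moreover have "(B ** W t) $ a $ b = 0" for t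
      using B(2) that by (simp add: matrix_matrix_mult_def cmats_def)
    ultimately have "W t $ a $ b = W 0 $ a $ b" by (intro constant_if_derivative_zero) simp
    then show ?thesis using Pf(3) that W0 by (simp add: cmats_def)
  qed
  show thesis
  proof
    show "smooth_on_open UNIV W" by (rule smooth_linear_ode[OF mm.bounded_linear_right W'])
    show "W 0 ** dagger (W 0) = P" using W0 Pf by simp
    show "W t ** dagger (W t) \<in> grassmann S m" for t
    proof -
      have "W t ** dagger (W t) \<in> cmats S"
        unfolding cmats_def using rows by (auto simp: matrix_matrix_mult_def dagger_def)
      moreover have "W t ** dagger (W t) ** (W t ** dagger (W t)) = W t ** dagger (W t)"
      proof -
        have "W t ** dagger (W t) ** (W t ** dagger (W t)) = W t ** (dagger (W t) ** W t) ** dagger (W t)"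
          by (simp add: matrix_mul_assoc)
        then show ?thesis by (simp add: WW WP)
      qed
      moreover have "trace (W t ** dagger (W t)) = of_nat m"
        using P WW[of t] trace_mul_sym[of "W t" "dagger (W t)"] by (simp add: grassmann_def)
      ultimately show ?thesis by (simp add: grassmann_def dagger_mult)
    qed
    have "((\<lambda>t. W t ** dagger (W t)) has_vector_derivative
        W 0 ** - (dagger (W 0) ** B) + B ** W 0 ** dagger (W 0)) (at 0)"
      by (rule mm.has_vector_derivative[OF W' dW'])
    moreover have "W 0 ** - (dagger (W 0) ** B) + B ** W 0 ** dagger (W 0) = X"
    proof -
      \<comment> \<open>The initial velocity is \<open>B P - P B\<close> with
        \<open>B = ad X P\<close>, a double commutator that returns \<open>X\<close> because
        \<open>X\<close> is off-diagonal.\<close>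
      have "W 0 ** - (dagger (W 0) ** B) + B ** W 0 ** dagger (W 0) = ad P (ad P X)"
        by (simp add: W0 Pf B_def ad_def mm.minus_right mm.diff_left mm.diff_right mm.add_left mm.add_right
            matrix_mul_assoc[symmetric] idem_absorb[OF Pf(1)])
      then show ?thesis using X(2) ad_ad_fixed_iff[OF Pf(1)] by simp
    qed
    ultimately show "((\<lambda>t. W t ** dagger (W t)) has_vector_derivative X) (at 0)" by simp
  qed
qed

definition ad_sq :: "complex^'i::finite^'i^'r::finite \<Rightarrow> complex^'i^'i^'r \<Rightarrow> complex^'i^'i^'r" where
  "ad_sq Q v = (\<chi> j. ad (Q $ j) (ad (Q $ j) (v $ j)))"

lemma grassmann_prod_her: "P \<in> grassmann_prod I m \<Longrightarrow> P \<in> her_prod I"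
  using grassmannD(4) by (fastforce simp: grassmann_prod_def her_prod_def)

text \<open>Obtained by differentiating the defining constraints along the curve: Hermitian symmetry
  is linear and passes to the velocity, and idempotence gives the off-diagonal equation.\<close>

lemma curve_off_diagonal:
  fixes I :: "'r::finite \<Rightarrow> 'i::finite set"
  assumes c: "curve_with_velocity (grassmann_prod I m) P v c"
  shows "v \<in> her_prod I" "P $ j ** v $ j + v $ j ** P $ j = v $ j"
proof -
  obtain e where e: "e > 0" "c ` {-e<..<e} \<subseteq> grassmann_prod I m"
    and c0: "c 0 = P" and d: "(c has_vector_derivative v) (at 0)"
    using c unfolding curve_with_velocity_def by blast
  have inM: "c t \<in> grassmann_prod I m" if "\<bar>t\<bar> < e" for t
  proof -
    have "t \<in> {-e<..<e}" using that by auto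
    then show ?thesis using e(2) by blast
  qed
  show "v \<in> her_prod I"
    by (rule has_vector_derivative_in_subspace[OF subspace_her_prod d e(1) grassmann_prod_her[OF inM]])
  have dj: "((\<lambda>t. c t $ j) has_vector_derivative v $ j) (at 0)"
    using d by (simp add: has_vector_derivative_vec)
  have "((\<lambda>t. c t $ j ** c t $ j - c t $ j) has_vector_derivative
      (c 0 $ j ** v $ j + v $ j ** c 0 $ j) - v $ j) (at 0)"
    by (intro has_vector_derivative_diff mm.has_vector_derivative dj)
  then have "(c 0 $ j ** v $ j + v $ j ** c 0 $ j) - v $ j \<in> {0}"
    by (rule has_vector_derivative_in_subspace[OF subspace_single_0 _ e(1)])
       (use inM in \<open>auto simp: grassmann_prod_def dest: grassmannD(1)\<close>)
  then show "P $ j ** v $ j + v $ j ** P $ j = v $ j" by (simp add: c0)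
qed

lemma tangent_space_grassmann_prod:
  fixes I :: "'r::finite \<Rightarrow> 'i::finite set"
  assumes P: "P \<in> grassmann_prod I m"
  shows "tangent_space (grassmann_prod I m) P = {v \<in> her_prod I. ad_sq P v = v}"
proof (intro equalityI subsetI)
  have Pj: "P $ j \<in> grassmann (I j) (m j)" for j using P by (simp add: grassmann_prod_def)
  note iff = ad_ad_fixed_iff[OF grassmannD(1)[OF Pj]]
  fix v
  show "v \<in> {v \<in> her_prod I. ad_sq P v = v}" if "v \<in> tangent_space (grassmann_prod I m) P"
    using that curve_off_diagonal[of I m P v] iff
    by (auto simp: tangent_space_def ad_sq_def vec_eq_iff[of "\<chi> j. _ j"])
  assume v: "v \<in> {v \<in> her_prod I. ad_sq P v = v}"
  have "\<forall>j. \<exists>W. smooth_on_open UNIV W \<and> (\<forall>t. W t ** dagger (W t) \<in> grassmann (I j) (m j)) \<and>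
    W 0 ** dagger (W 0) = P $ j \<and> ((\<lambda>t. W t ** dagger (W t)) has_vector_derivative v $ j) (at 0)"
  proof
    fix j
    have "v $ j \<in> her (I j)" "P $ j ** v $ j + v $ j ** P $ j = v $ j"
      using v iff[of j "v $ j"] by (auto simp: her_prod_def ad_sq_def vec_eq_iff[of "\<chi> j. _ j"])
    then show "\<exists>W. smooth_on_open UNIV W \<and> (\<forall>t. W t ** dagger (W t) \<in> grassmann (I j) (m j)) \<and>
        W 0 ** dagger (W 0) = P $ j \<and> ((\<lambda>t. W t ** dagger (W t)) has_vector_derivative v $ j) (at 0)"
      by (rule grassmann_curve[OF Pj]) (intro exI conjI allI)
  qed
  from choice[OF this]
  obtain W where W: "\<forall>j. smooth_on_open UNIV (W j) \<and>
    (\<forall>t. W j t ** dagger (W j t) \<in> grassmann (I j) (m j)) \<and> W j 0 ** dagger (W j 0) = P $ j \<and>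
    ((\<lambda>t. W j t ** dagger (W j t)) has_vector_derivative v $ j) (at 0)" ..
  define c where "c t = (\<chi> j. W j t ** dagger (W j t))" for t
  have "smooth_on_open UNIV (\<lambda>t. W j t ** dagger (W j t))" for j
    by (rule smooth_on_open_bilinear[OF mm.bounded_bilinear_axioms _
          smooth_on_open_compose_linear[OF bounded_linear_dagger]]) (use W in auto)
  then have "smooth_on_open UNIV c" by (intro smooth_on_open_vec[of _ c]) (simp_all add: c_def)
  then have "smooth_on_open {-1<..<1} c" by (rule smooth_on_open_subset) auto
  moreover have "c t \<in> grassmann_prod I m" for t
    using W by (simp add: c_def grassmann_prod_def)
  moreover have "c 0 = P" "(c has_vector_derivative v) (at 0)"
    using W by (simp_all add: c_def vec_eq_iff[of "\<chi> j. _ j"] has_vector_derivative_vec)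
  ultimately have "curve_with_velocity (grassmann_prod I m) P v c"
    unfolding curve_with_velocity_def by (auto intro: exI[of _ 1])
  then show "v \<in> tangent_space (grassmann_prod I m) P" by (auto simp: tangent_space_def)
qed

lemma has_derivative_ad_sq:
  "((\<lambda>Q. ad_sq Q w) has_derivative
    (\<lambda>v. \<chi> j. ad (v $ j) (ad (P $ j) (w $ j)) + ad (P $ j) (ad (v $ j) (w $ j)))) (at P)"
proof -
  have n: "((\<lambda>Q. Q $ j) has_derivative (\<lambda>v. v $ j)) (at P)" for j :: 'b
    by (rule bounded_linear_imp_has_derivative[OF bounded_linear_vec_nth])
  show ?thesis unfolding ad_sq_def
    by (rule has_derivative_vec)
       (auto intro!: has_derivative_eq_rhs[OF ad.FDERIV[OF n ad.FDERIV[OF n has_derivative_const]]]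
         simp: ad.zero_right)
qed

lemma smooth_ad_sq: "smooth_on_open UNIV (\<lambda>Q. ad_sq Q w)"
  unfolding ad_sq_def
  by (rule smooth_on_open_vec)
     (auto intro!: smooth_on_open_bilinear[OF bounded_bilinear_ad] smooth_on_open_const
        smooth_on_open_linear[OF open_UNIV bounded_linear_vec_nth])

text \<open>\<open>ad P\<close> is skew for the trace form, so its square is symmetric; on Hermitian
  matrices the real inner product is that form.\<close>

lemma inner_ad_her:
  assumes "dagger P = P" "dagger X = X" "dagger Y = Y"
  shows "ad P (ad P X) \<bullet> Y = X \<bullet> ad P (ad P Y)"
proof -
  have c: "trace (ad P Z ** W) = - trace (Z ** ad P W)" for Z W
    by (simp add: ad_def mm.diff_left mm.diff_right mm.add_left mm.add_right trace_sub matrix_mul_assoc[symmetric])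
       (metis matrix_mul_assoc trace_mul_sym)
  have "dagger (ad P (ad P X)) = ad P (ad P X)"
    using assms by (simp add: ad_def dagger_diff dagger_add dagger_mult mm.diff_left mm.diff_right mm.add_left mm.add_right matrix_mul_assoc)
  then show ?thesis using assms by (simp add: inner_matrix_trace c)
qed

lemma projected_submanifold_grassmann_prod:
  fixes I :: "'r::finite \<Rightarrow> 'i::finite set"
  shows "projected_submanifold (grassmann_prod I m) (her_prod I) ad_sq"
proof (rule projected_submanifold.intro)
  show "subspace (her_prod I)" by (rule subspace_her_prod)
  show "linear (ad_sq p)" for p :: "complex^'i^'i^'r"
    by (rule linearI) (auto simp: ad_sq_def vec_eq_iff[of "\<chi> j. _ j"] ad.add_right ad.scaleR_right)
  show "smooth_on_open UNIV (\<lambda>p. ad_sq p v)" for v :: "complex^'i^'i^'r" by (rule smooth_ad_sq)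
next
  fix p v :: "complex^'i^'i^'r" assume p: "p \<in> grassmann_prod I m"
  show "tangent_space (grassmann_prod I m) p = {v \<in> her_prod I. ad_sq p v = v}"
    by (rule tangent_space_grassmann_prod[OF p])
  have pj: "p $ j \<in> grassmann (I j) (m j)" for j using p by (simp add: grassmann_prod_def)
  show "ad_sq p (ad_sq p v) = ad_sq p v"
    by (simp add: ad_sq_def ad_ad_ad[OF grassmannD(1)[OF pj]])
  assume v: "v \<in> her_prod I"
  then show "ad_sq p v \<in> her_prod I"
    using her_ad_ad[OF grassmannD(4)[OF pj]] by (auto simp: her_prod_def ad_sq_def)
  show "ad_sq p v \<bullet> w = v \<bullet> ad_sq p w" if w: "w \<in> her_prod I" for w
    unfolding inner_vec_def[of "ad_sq p v"] inner_vec_def[of v]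
    using v w by (intro sum.cong refl)
      (auto simp: ad_sq_def her_prod_def her_def intro!: inner_ad_her grassmannD(2)[OF pj])
next
  fix p v w :: "complex^'i^'i^'r"
  assume p: "p \<in> grassmann_prod I m" and v: "v \<in> tangent_space (grassmann_prod I m) p"
    and w: "w \<in> tangent_space (grassmann_prod I m) p"
  have pj: "p $ j \<in> grassmann (I j) (m j)" for j using p by (simp add: grassmann_prod_def)
  have off: "p $ j ** u $ j + u $ j ** p $ j = u $ j"
    if "u \<in> tangent_space (grassmann_prod I m) p" for u j
    using that curve_off_diagonal(2) by (auto simp: tangent_space_def)
  show "frechet_derivative (\<lambda>q. ad_sq q w) (at p) v = frechet_derivative (\<lambda>q. ad_sq q v) (at p) w"
    unfolding frechet_derivative_at[OF has_derivative_ad_sq, symmetric]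
    by (simp add: vec_eq_iff[of "\<chi> j. _ j"]
        ad_second_symmetric[OF grassmannD(1)[OF pj] off[OF v] off[OF w]])
qed

section \<open>The Rayleigh quotient\<close>

text \<open>The partial trace that represents \<open>W \<mapsto> tr (A (X\<^sub>1 \<otimes> \<dots> \<otimes> W \<otimes> \<dots> \<otimes> X\<^sub>r))\<close>, with \<open>W\<close> in
  position \<open>j\<close>. It does not depend on \<open>X\<^sub>j\<close>.\<close>

definition partial :: "complex^('r::finite \<Rightarrow> 'i::finite)^('r \<Rightarrow> 'i) \<Rightarrow> 'r \<Rightarrow> complex^'i^'i^'r \<Rightarrow> complex^'i^'i"
  where "partial A j X = (\<chi> a b. \<Sum>f\<in>UNIV. \<Sum>g\<in>UNIV.
    if f j = a \<and> g j = b then A $ f $ g * (\<Prod>k\<in>UNIV - {j}. X $ k $ g k $ f k) else 0)"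

lemma kron_upd: "kron (upd X j W) $ g $ f = W $ g j $ f j * (\<Prod>k\<in>UNIV - {j}. X $ k $ g k $ f k)"
  unfolding kron_def by (simp add: upd_def prod.remove[of UNIV j])

lemma trace_kron_upd:
  fixes A :: "complex^('r::finite \<Rightarrow> 'i::finite)^('r \<Rightarrow> 'i)"
  shows "trace (A ** kron (upd X j W)) = trace (partial A j X ** W)"
proof -
  let ?c = "\<lambda>f g. A $ f $ g * (\<Prod>k\<in>UNIV - {j}. X $ k $ g k $ f k)"
  have "trace (partial A j X ** W) = (\<Sum>a\<in>UNIV. \<Sum>b\<in>UNIV. \<Sum>f\<in>UNIV. \<Sum>g\<in>UNIV.
      if f j = a then if g j = b then ?c f g * W $ b $ a else 0 else 0)"
    unfolding trace_def matrix_matrix_mult_def partial_def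
    by (simp add: sum_distrib_right if_distrib[of "\<lambda>x. x * _"] cong: if_cong) (intro sum.cong refl, auto)
  also have "\<dots> = (\<Sum>f\<in>UNIV. \<Sum>g\<in>UNIV. \<Sum>a\<in>UNIV. \<Sum>b\<in>UNIV.
      if f j = a then if g j = b then ?c f g * W $ b $ a else 0 else 0)"
    by (simp only: sum.swap[of _ "UNIV::('r \<Rightarrow> 'i) set" "UNIV::'i set"])
  also have "\<dots> = (\<Sum>f\<in>UNIV. \<Sum>g\<in>UNIV. ?c f g * W $ g j $ f j)"
  proof (intro sum.cong refl)
    fix f g :: "'r \<Rightarrow> 'i"
    have "(\<Sum>b\<in>UNIV. if f j = a then if g j = b then ?c f g * W $ b $ a else 0 else 0) =
        (if f j = a then ?c f g * W $ g j $ a else 0)" for a by simp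
    then show "(\<Sum>a\<in>UNIV. \<Sum>b\<in>UNIV. if f j = a then if g j = b then ?c f g * W $ b $ a else 0 else 0) =
        ?c f g * W $ g j $ f j" by simp
  qed
  also have "\<dots> = trace (A ** kron (upd X j W))"
    by (simp add: trace_def matrix_matrix_mult_def kron_upd mult_ac)
  finally show ?thesis by simp
qed

lemma partial_cmats:
  assumes "A \<in> cmats (multi I)"
  shows "partial A j X \<in> cmats (I j)"
proof -
  have "A $ f $ g = 0" if "f j \<notin> I j \<or> g j \<notin> I j" for f g
    using assms that by (auto simp: cmats_def multi_def)
  then show ?thesis by (auto simp: cmats_def partial_def intro!: sum.neutral)
qed

text \<open>Conjugation interchanges the two multi-indices of \<open>A\<close> and of every
  remaining factor. This puts the Euclidean gradient among the Hermitian tuples, where the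
  projection applies.\<close>

lemma partial_her:
  assumes A: "A \<in> her (multi I)" and X: "X \<in> her_prod I"
  shows "partial A j X \<in> her (I j)"
proof -
  have a: "cnj (A $ f $ g) = A $ g $ f" for f g
    using A by (auto simp: her_def dagger_def vec_eq_iff)
  have x: "cnj (X $ k $ u $ v) = X $ k $ v $ u" for k u v
    using X by (auto simp: her_prod_def her_def dagger_def vec_eq_iff)
  have "cnj (partial A j X $ b $ a) = partial A j X $ a $ b" for a b
    unfolding partial_def
    by (subst (2) vec_lambda_beta, subst sum.swap)
       (auto simp: a x if_distrib[of cnj] cong: if_cong intro!: sum.cong)
  moreover have "partial A j X \<in> cmats (I j)" using A by (intro partial_cmats) (simp add: her_def)
  ultimately show ?thesis by (simp add: her_def dagger_def vec_eq_iff)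
qed

text \<open>With the unit in position \<open>j\<close>, the product with \<open>Z\<close> there is
  just \<open>Z\<close>, so the partial trace satisfies the characterization of
  \<open>Psi\<close>.\<close>

lemma Psi_upd_idm:
  assumes A: "A \<in> cmats (multi I)"
  shows "Psi I A j (upd X j (idm (I j))) = partial A j X"
proof -
  have "partial A j X \<in> cmats (I j) \<and> (\<forall>Z\<in>cmats (I j).
      trace (A ** kron (upd (upd X j (idm (I j))) j (upd X j (idm (I j)) $ j ** Z))) = trace (partial A j X ** Z))"
  proof (intro conjI ballI)
    fix Z assume Z: "Z \<in> cmats (I j)"
    have "idm (I j) ** Z = Z"
    proof -
      have "(\<Sum>c\<in>UNIV. (if a = c \<and> a \<in> I j then 1 else 0) * Z $ c $ b) = Z $ a $ b" for a b
      proof (cases "a \<in> I j")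
        case True
        have "(if a = c \<and> a \<in> I j then 1 else 0) * Z $ c $ b = (if a = c then Z $ c $ b else 0)" for c
          using True by simp
        then show ?thesis by simp
      next
        case False
        then show ?thesis using Z by (simp add: cmats_def)
      qed
      then show ?thesis by (simp add: idm_def matrix_matrix_mult_def vec_eq_iff)
    qed
    moreover have "upd (upd X j (idm (I j))) j W = upd X j W" for W by (simp add: upd_def vec_eq_iff)
    moreover have "upd X j (idm (I j)) $ j = idm (I j)" by (simp add: upd_def)
    ultimately show "trace (A ** kron (upd (upd X j (idm (I j))) j (upd X j (idm (I j)) $ j ** Z))) =
        trace (partial A j X ** Z)"
      by (simp add: trace_kron_upd)
  qed (rule partial_cmats[OF A])
  then show ?thesis
    unfolding Psi_def by (rule the1_equality[OF Psi_well_defined])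
qed

section \<open>Derivatives of the partial traces and of the Rayleigh quotient\<close>

lemma smooth_entry: "smooth_on_open UNIV (\<lambda>X :: complex^'i::finite^'i^'r::finite. X $ k $ a $ b)"
  by (intro smooth_on_open_compose_linear[OF bounded_linear_vec_nth] smooth_on_open_linear
      bounded_linear_vec_nth) auto

lemma smooth_partial:
  fixes A :: "complex^('r::finite \<Rightarrow> 'i::finite)^('r \<Rightarrow> 'i)"
  shows "smooth_on_open UNIV (partial A j)"
  unfolding partial_def
proof (intro smooth_on_open_vec open_UNIV)
  fix a b :: 'i
  have "smooth_on_open UNIV (\<lambda>X. if f j = a \<and> g j = b
      then A $ f $ g * (\<Prod>k\<in>UNIV - {j}. X $ k $ g k $ f k) else 0)" for f g
    by (cases "f j = a \<and> g j = b")
       (auto simp: smooth_on_open_const intro!: smooth_on_open_prod smooth_entry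
          smooth_on_open_bilinear[OF bounded_bilinear_mult] smooth_on_open_const)
  then show "smooth_on_open UNIV (\<lambda>X. (\<chi> a b. \<Sum>f\<in>UNIV. \<Sum>g\<in>UNIV. if f j = a \<and> g j = b
      then A $ f $ g * (\<Prod>k\<in>UNIV - {j}. X $ k $ g k $ f k) else 0) $ a $ b)"
    by (simp add: smooth_on_open_sum)
qed

lemma has_derivative_entry:
  "((\<lambda>X :: complex^'i::finite^'i^'r::finite. X $ k $ a $ b) has_derivative (\<lambda>v. v $ k $ a $ b)) (at P)"
  by (intro bounded_linear_imp_has_derivative bounded_linear_compose[OF bounded_linear_vec_nth]
      bounded_linear_vec_nth)

text \<open>The partial trace is multilinear in the components other than \<open>j\<close>, so its
  derivative replaces one of them at a time. This is where the sum over \<open>k\<close> different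
  from \<open>j\<close> in the Hessian originates.\<close>

lemma has_derivative_partial:
  fixes A :: "complex^('r::finite \<Rightarrow> 'i::finite)^('r \<Rightarrow> 'i)"
  shows "(partial A j has_derivative (\<lambda>v. \<Sum>k\<in>UNIV - {j}. partial A j (upd P k (v $ k)))) (at P)"
proof (intro has_derivative_vec)
  fix a b :: 'i
  let ?p = "\<lambda>X f g. \<Prod>k\<in>UNIV - {j}. X $ k $ g k $ f k"
  have d: "((\<lambda>X. ?p X f g) has_derivative (\<lambda>v. \<Sum>k\<in>UNIV - {j}. ?p (upd P k (v $ k)) f g)) (at P)"
    for f g
  proof (rule has_derivative_eq_rhs[OF has_derivative_prod[OF has_derivative_entry]], rule ext, rule sum.cong[OF refl])
    fix v :: "complex^'i^'i^'r" and k assume k: "k \<in> UNIV - {j}"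
    have "?p (upd P k (v $ k)) f g = v $ k $ g k $ f k * (\<Prod>l\<in>UNIV - {j} - {k}. upd P k (v $ k) $ l $ g l $ f l)"
      using k by (subst prod.remove[of _ k]) (auto simp: upd_def)
    also have "(\<Prod>l\<in>UNIV - {j} - {k}. upd P k (v $ k) $ l $ g l $ f l) = (\<Prod>l\<in>UNIV - {j} - {k}. P $ l $ g l $ f l)"
      by (intro prod.cong refl) (auto simp: upd_def)
    finally show "v $ k $ g k $ f k * (\<Prod>l\<in>UNIV - {j} - {k}. P $ l $ g l $ f l) = ?p (upd P k (v $ k)) f g" ..
  qed
  have "((\<lambda>X. if f j = a \<and> g j = b then A $ f $ g * ?p X f g else 0) has_derivative
      (\<lambda>v. if f j = a \<and> g j = b then A $ f $ g * (\<Sum>k\<in>UNIV - {j}. ?p (upd P k (v $ k)) f g) else 0)) (at P)"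
    for f g
    by (cases "f j = a \<and> g j = b") (auto intro!: has_derivative_mult_right d)
  then have "((\<lambda>X. \<Sum>f\<in>UNIV. \<Sum>g\<in>UNIV. if f j = a \<and> g j = b then A $ f $ g * ?p X f g else 0) has_derivative
      (\<lambda>v. \<Sum>f\<in>UNIV. \<Sum>g\<in>UNIV.
        if f j = a \<and> g j = b then A $ f $ g * (\<Sum>k\<in>UNIV - {j}. ?p (upd P k (v $ k)) f g) else 0)) (at P)"
    by (intro has_derivative_sum)
  then have "((\<lambda>X. partial A j X $ a $ b) has_derivative
      (\<lambda>v. \<Sum>f\<in>UNIV. \<Sum>g\<in>UNIV.
        if f j = a \<and> g j = b then A $ f $ g * (\<Sum>k\<in>UNIV - {j}. ?p (upd P k (v $ k)) f g) else 0)) (at P)"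
    by (simp add: partial_def)
  then show "((\<lambda>X. partial A j X $ a $ b) has_derivative
      (\<lambda>v. (\<Sum>k\<in>UNIV - {j}. partial A j (upd P k (v $ k))) $ a $ b)) (at P)"
  proof (rule has_derivative_eq_rhs, intro ext)
    fix v :: "complex^'i^'i^'r"
    have "(\<Sum>k\<in>UNIV - {j}. partial A j (upd P k (v $ k))) $ a $ b =
        (\<Sum>k\<in>UNIV - {j}. \<Sum>f\<in>UNIV. \<Sum>g\<in>UNIV.
          if f j = a \<and> g j = b then A $ f $ g * ?p (upd P k (v $ k)) f g else 0)"
      by (simp add: partial_def)
    also have "\<dots> = (\<Sum>f\<in>UNIV. \<Sum>k\<in>UNIV - {j}. \<Sum>g\<in>UNIV.
          if f j = a \<and> g j = b then A $ f $ g * ?p (upd P k (v $ k)) f g else 0)"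
      by (rule sum.swap)
    also have "\<dots> = (\<Sum>f\<in>UNIV. \<Sum>g\<in>UNIV. \<Sum>k\<in>UNIV - {j}.
          if f j = a \<and> g j = b then A $ f $ g * ?p (upd P k (v $ k)) f g else 0)"
      by (intro sum.cong refl sum.swap)
    also have "\<dots> = (\<Sum>f\<in>UNIV. \<Sum>g\<in>UNIV.
        if f j = a \<and> g j = b then A $ f $ g * (\<Sum>k\<in>UNIV - {j}. ?p (upd P k (v $ k)) f g) else 0)"
      by (intro sum.cong refl) (auto simp: sum_distrib_left)
    finally show "(\<Sum>f\<in>UNIV. \<Sum>g\<in>UNIV.
        if f j = a \<and> g j = b then A $ f $ g * (\<Sum>k\<in>UNIV - {j}. ?p (upd P k (v $ k)) f g) else 0) =
        (\<Sum>k\<in>UNIV - {j}. partial A j (upd P k (v $ k))) $ a $ b" ..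
  qed
qed

lemma rayleigh_entries: "rayleigh A X = Re (\<Sum>f\<in>UNIV. \<Sum>g\<in>UNIV. A $ f $ g * (\<Prod>k\<in>UNIV. X $ k $ g k $ f k))"
  by (simp add: rayleigh_def trace_def matrix_matrix_mult_def kron_def)

lemma smooth_rayleigh: "smooth_on_open UNIV (rayleigh A)"
  unfolding rayleigh_entries[abs_def]
  by (intro smooth_on_open_compose_linear[OF bounded_linear_Re] smooth_on_open_sum smooth_on_open_prod
      smooth_on_open_bilinear[OF bounded_bilinear_mult] smooth_on_open_const smooth_entry open_UNIV)

text \<open>Again the product rule for a multilinear expression: the term with component
  \<open>k\<close> replaced by \<open>v $ k\<close> is a trace against the partial trace at
  \<open>k\<close>.\<close>

lemma has_derivative_rayleigh:
  fixes A :: "complex^('r::finite \<Rightarrow> 'i::finite)^('r \<Rightarrow> 'i)"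
  shows "(rayleigh A has_derivative (\<lambda>v. \<Sum>k\<in>UNIV. Re (trace (partial A k P ** v $ k)))) (at P)"
  unfolding rayleigh_entries[abs_def]
proof (rule has_derivative_eq_rhs)
  show "((\<lambda>X. Re (\<Sum>f\<in>UNIV. \<Sum>g\<in>UNIV. A $ f $ g * (\<Prod>k\<in>UNIV. X $ k $ g k $ f k))) has_derivative
      (\<lambda>v. Re (\<Sum>f\<in>UNIV. \<Sum>g\<in>UNIV. A $ f $ g *
        (\<Sum>k\<in>UNIV. v $ k $ g k $ f k * (\<Prod>l\<in>UNIV - {k}. P $ l $ g l $ f l))))) (at P)"
    by (intro bounded_linear.has_derivative[OF bounded_linear_Re] has_derivative_sum
        has_derivative_mult_right has_derivative_prod has_derivative_entry)
  have "(\<Sum>f\<in>UNIV. \<Sum>g\<in>UNIV. A $ f $ g *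
      (\<Sum>k\<in>UNIV. v $ k $ g k $ f k * (\<Prod>l\<in>UNIV - {k}. P $ l $ g l $ f l))) =
      (\<Sum>k\<in>UNIV. trace (partial A k P ** v $ k))" for v :: "complex^'i^'i^'r"
  proof -
    have "(\<Sum>k\<in>UNIV. trace (partial A k P ** v $ k)) = (\<Sum>k\<in>UNIV. \<Sum>f\<in>UNIV. \<Sum>g\<in>UNIV.
        A $ f $ g * (v $ k $ g k $ f k * (\<Prod>l\<in>UNIV - {k}. P $ l $ g l $ f l)))"
      unfolding trace_kron_upd[symmetric]
      by (simp add: trace_def matrix_matrix_mult_def kron_upd)
    also have "\<dots> = (\<Sum>f\<in>UNIV. \<Sum>k\<in>UNIV. \<Sum>g\<in>UNIV.
        A $ f $ g * (v $ k $ g k $ f k * (\<Prod>l\<in>UNIV - {k}. P $ l $ g l $ f l)))"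
      by (rule sum.swap)
    also have "\<dots> = (\<Sum>f\<in>UNIV. \<Sum>g\<in>UNIV. \<Sum>k\<in>UNIV.
        A $ f $ g * (v $ k $ g k $ f k * (\<Prod>l\<in>UNIV - {k}. P $ l $ g l $ f l)))"
      by (intro sum.cong refl sum.swap)
    finally show ?thesis by (simp add: sum_distrib_left)
  qed
  then show "(\<lambda>v. Re (\<Sum>f\<in>UNIV. \<Sum>g\<in>UNIV. A $ f $ g *
      (\<Sum>k\<in>UNIV. v $ k $ g k $ f k * (\<Prod>l\<in>UNIV - {k}. P $ l $ g l $ f l)))) =
      (\<lambda>v. \<Sum>k\<in>UNIV. Re (trace (partial A k P ** v $ k)))" by simp
qed

theorem theorem3p9:
  fixes I :: "'r::finite \<Rightarrow> 'i::finite set"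
    and m n :: "'r \<Rightarrow> nat"
    and A :: "complex^('r \<Rightarrow> 'i)^('r \<Rightarrow> 'i)"
    and P :: "complex^'i^'i^'r"
  assumes "\<And>j. card (I j) = n j"
    and "\<And>j. 1 \<le> m j" and "\<And>j. m j \<le> n j"
    and "A \<in> her (multi I)"
    and "P \<in> grassmann_prod I m"
  defines "T \<equiv> tangent_space (grassmann_prod I m) P"
    and "Hess \<equiv> riem_hessian (grassmann_prod I m) (rayleigh A) P"
    and "A_hat \<equiv> (\<lambda>j. Psi I A j (upd P j (idm (I j))))"
  defines "H \<equiv> (\<lambda>\<xi>. \<chi> j. - ad (P $ j) (ad (A_hat j) (\<xi> $ j)) +
      (\<Sum>k\<in>UNIV - {j}. ad (P $ j) (ad (P $ j) (Psi I A j (upd (upd P j (idm (I j))) k (\<xi> $ k))))))"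
  shows "self_adjoint_on T Hess \<and>
    (\<forall>\<xi>\<in>T. Hess \<xi> = H \<xi>) \<and>
    (\<forall>L. self_adjoint_on T L \<and> (\<forall>\<xi>\<in>T. L \<xi> = H \<xi>) \<longrightarrow> (\<forall>\<xi>\<in>T. L \<xi> = Hess \<xi>))"
proof -
  let ?M = "grassmann_prod I m"
  interpret projected_submanifold ?M "her_prod I" ad_sq
    by (rule projected_submanifold_grassmann_prod)
  note A = \<open>A \<in> her (multi I)\<close> and P = \<open>P \<in> ?M\<close>
  have Ac: "A \<in> cmats (multi I)" using A by (simp add: her_def)
  define \<Phi> where "\<Phi> X = (\<chi> j. partial A j X)" for X
  define \<Phi>' where "\<Phi>' v = (\<chi> j. \<Sum>k\<in>UNIV - {j}. partial A j (upd P k (v $ k)))" for v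
  \<comment> \<open>A polynomial map on the whole space that restricts to the Riemannian gradient on
    the manifold.\<close>
  define G where "G X = ad_sq X (\<Phi> X)" for X
  have \<Phi>_her: "\<Phi> Q \<in> her_prod I" if "Q \<in> ?M" for Q
    using partial_her[OF A grassmann_prod_her[OF that]] by (simp add: \<Phi>_def her_prod_def)
  have smooth_\<Phi>: "smooth_on_open UNIV \<Phi>"
    by (rule smooth_on_open_vec) (auto simp: \<Phi>_def smooth_partial)
  have smooth_G: "smooth_on_open UNIV G"
    unfolding G_def by (rule smooth_\<pi>_along[OF smooth_\<Phi>])
  have G_tangent: "G Q \<in> tangent_space ?M Q" if "Q \<in> ?M" for Q
    unfolding G_def by (rule \<pi>_tangent[OF that \<Phi>_her[OF that]])
  have G_deriv: "frechet_derivative (rayleigh A) (at Q) v = G Q \<bullet> v"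
    if Q: "Q \<in> ?M" and v: "v \<in> tangent_space ?M Q" for Q v
  proof -
    have "G Q \<bullet> v = \<Phi> Q \<bullet> v"
      unfolding G_def by (rule \<pi>_inner_tangent[OF Q \<Phi>_her[OF Q] v])
    also have "\<dots> = (\<Sum>k\<in>UNIV. Re (trace (partial A k Q ** v $ k)))"
      unfolding inner_vec_def[of "\<Phi> Q"] inner_matrix_trace
      using \<Phi>_her[OF Q] by (simp add: \<Phi>_def her_prod_def her_def)
    also have "\<dots> = frechet_derivative (rayleigh A) (at Q) v"
      using fun_cong[OF frechet_derivative_at[OF has_derivative_rayleigh[of A Q]]] by simp
    finally show ?thesis ..
  qed
  note hess = riem_hessian_eq[OF smooth_rayleigh smooth_G G_tangent G_deriv P]
  have sa: "self_adjoint_on T Hess"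
    unfolding T_def Hess_def
    by (rule self_adjoint_riem_hessian[OF smooth_rayleigh smooth_G G_tangent G_deriv P])
  have eq: "Hess \<xi> = H \<xi>" if \<xi>: "\<xi> \<in> T" for \<xi>
  proof -
    have "(\<Phi> has_derivative \<Phi>') (at P)"
      by (rule has_derivative_vec) (simp add: \<Phi>_def \<Phi>'_def has_derivative_partial)
    from has_derivative_\<pi>_along[OF this]
    have "frechet_derivative G (at P) \<xi> =
        ad_sq P (\<Phi>' \<xi>) + frechet_derivative (\<lambda>Q. ad_sq Q (\<Phi> P)) (at P) \<xi>"
      unfolding G_def by (rule fun_cong[OF frechet_derivative_at, symmetric])
    also have "frechet_derivative (\<lambda>Q. ad_sq Q (\<Phi> P)) (at P) \<xi> =
        (\<chi> j. ad (\<xi> $ j) (ad (P $ j) (\<Phi> P $ j)) + ad (P $ j) (ad (\<xi> $ j) (\<Phi> P $ j)))"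
      by (rule fun_cong[OF frechet_derivative_at[OF has_derivative_ad_sq], symmetric])
    finally have DG: "frechet_derivative G (at P) \<xi> = ad_sq P (\<Phi>' \<xi>) +
        (\<chi> j. ad (\<xi> $ j) (ad (P $ j) (\<Phi> P $ j)) + ad (P $ j) (ad (\<xi> $ j) (\<Phi> P $ j)))" .
    have "Hess \<xi> $ j = H \<xi> $ j" for j
    proof -
      have PP: "P $ j ** P $ j = P $ j"
        using P grassmannD(1) by (auto simp: grassmann_prod_def)
      have off: "P $ j ** \<xi> $ j + \<xi> $ j ** P $ j = \<xi> $ j"
        using \<xi> curve_off_diagonal(2) by (auto simp: T_def tangent_space_def)
      have "Hess \<xi> $ j = ad_sq P (frechet_derivative G (at P) \<xi>) $ j"
        using hess \<xi> by (simp add: Hess_def T_def)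
      \<comment> \<open>Projecting once more leaves the first term of \<open>DG\<close> fixed, kills
        the second as a commutator of off-diagonal matrices, and shortens the third since the cube
        of \<open>ad (P $ j)\<close> is itself.\<close>
      also have "\<dots> = ad (P $ j) (ad (P $ j) (\<Phi>' \<xi> $ j)) + ad (P $ j) (ad (\<xi> $ j) (\<Phi> P $ j))"
        by (simp add: DG ad_sq_def ad.add_right ad_ad_ad[OF PP] ad.zero_right
            ad_ad_off_diagonal[OF PP off off_diagonal_ad[OF PP]])
      also have "ad (\<xi> $ j) (\<Phi> P $ j) = - ad (A_hat j) (\<xi> $ j)"
        by (simp add: A_hat_def \<Phi>_def Psi_upd_idm[OF Ac] ad_def)
      also have "ad (P $ j) (ad (P $ j) (\<Phi>' \<xi> $ j)) =
          (\<Sum>k\<in>UNIV - {j}. ad (P $ j) (ad (P $ j) (Psi I A j (upd (upd P j (idm (I j))) k (\<xi> $ k)))))"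
      proof -
        \<comment> \<open>Updates in different positions commute, so the unit matrix can be treated
          as the last one inserted.\<close>
        have "Psi I A j (upd (upd P j (idm (I j))) k (\<xi> $ k)) = partial A j (upd P k (\<xi> $ k))"
          if "k \<noteq> j" for k
        proof -
          have "upd (upd P j (idm (I j))) k (\<xi> $ k) = upd (upd P k (\<xi> $ k)) j (idm (I j))"
            using that by (simp add: upd_def vec_eq_iff)
          then show ?thesis by (simp add: Psi_upd_idm[OF Ac])
        qed
        then show ?thesis by (simp add: \<Phi>'_def ad.sum_right)
      qed
      finally show ?thesis by (simp add: H_def ad.minus_right)
    qed
    then show ?thesis by (simp add: vec_eq_iff)
  qed
  \<comment> \<open>The uniqueness clause follows because any operator equal to \<open>H\<close> on
    \<open>T\<close> equals \<open>Hess\<close> there.\<close>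
  show ?thesis using sa eq by simp
qed

end
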